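(* Let $\mathbf w\in\mathbb R^d_{>0}$, $0<\delta<1/2$, and suppose that the inclines $\Theta_{\widehat{\mathbf w}}$ are $\kappa$-multiplicatively approximable (for some $\kappa>0$). Then $$N(t;\mathbf w,\mathbf u)=\mathscr L_d(t;\mathbf w,\{\mathbf u\})+R(t;\mathbf w,\{\mathbf u\}),$$ where the leading term is defined by $$\mathscr L_d(t;\mathbf w,\{\mathbf u\})=\frac{1}{d!\,w_1\cdots w_d}\,\mathcal B^{\star}_d\big(t+\mathbf w\cdot((\mathbf u));\mathbf w\big),$$ and the error $$\mathcal R_\delta(t;\mathbf w)=\sup_{\mathbf u\in\mathcal U(\delta)}\mathcal R(t;\mathbf w,\{\mathbf u\}),\qquad \mathcal R(t;\mathbf w,\{\mathbf u\})=\max\{|R(t-0;\mathbf w,\{\mathbf u\})|,\,|R(t+0;\mathbf w,\{\mathbf u\})|\},$$ satisfies the bound $$\mathcal R_\delta(t;\mathbf w)=O_{\widehat{\mathbf w},\delta,\epsilon}\Big(S(\Theta_{\widehat{\mathbf w}},T^{1+\epsilon})+T^{-1}t^{d-1}\Big)$$ for any $\epsilon>0$, where $T$ is an arbitrarily large parameter and the subscripts indicate that the implied constant depends on $\widehat{\mathbf w}$, $\delta$ and $\epsilon$.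
   Context: Notation: $d\ge2$; $[d]=\{1,\dots,d\}$; $\mathbf w\cdot\mathbf x=\sum_j w_jx_j$; $\{u\}$ is the fractional part of $u\in\mathbb R$, $((u))=\{u\}-\tfrac12$, $\langle u\rangle$ is the distance from $u$ to the nearest integer; $\{\mathbf u\}$ and $((\mathbf u))$ are taken coordinatewise for $\mathbf u\in\mathbb R^d$. $f(t\mp0)=\lim_{\alpha\downarrow0}f(t\mp\alpha)$. The bound concerns the behaviour for large $t$. Counting function: for $t>0$ and $\mathbf u\in\mathbb R^d$, $N(t;\mathbf w,\mathbf u)=\#\{\mathbf x\in\mathbb Z^d: x_j>u_j\ (j\in[d]),\ \mathbf w\cdot\mathbf x<t+\mathbf w\cdot\mathbf u\}$. It is $\mathbb Z^d$-periodic in $\mathbf u$. $\mathcal U(\delta)=\{\mathbf u\in\mathbb R^d:\langle u_j\rangle\ge\delta,\ j\in[d]\}$. Multiple Bernoulli polynomials $\mathcal B^\star_k(t;\mathbf w)$ are defined by $\Big(\prod_{j=1}^d\frac{w_js\,e^{w_js/2}}{e^{w_js}-1}\Big)e^{st}=\sum_{k\ge0}\mathcal B^\star_k(t;\mathbf w)\frac{s^k}{k!}$. Equivalently $\mathcal B^\star_k(t;\mathbf w)=\sum_{0\le n\le\lfloor k/2\rfloor}\frac{k!}{(2n)!(k-2n)!}\mathcal B^\star_{2n}(\mathbf w)t^{k-2n}$ with $\mathcal B^\star_{2n}(\mathbf w)=\sum_{n_1+\dots+n_d=n}\frac{(2n)!}{(2n_1)!\cdots(2n_d)!}\prod_jB_{2n_j}(1/2)w_j^{2n_j}$,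 where $B_k(u)$ are the standard Bernoulli polynomials. Inclines: $\widehat{\mathbf w}=\mathbf w/|\mathbf w|_2$ (with $|\cdot|_2$ the Euclidean norm) and $\Theta_{\widehat{\mathbf w}}=[\theta_{j,l}]_{j,l=1}^d$ with $\theta_{j,l}=w_l/w_j$. For $\kappa>0$ the inclines are $\kappa$-multiplicatively approximable if there is a constant $c(\Theta_{\widehat{\mathbf w}})>0$ with $m^{1+\kappa}\prod_{l\in[d],l\ne j}\langle\theta_{j,l}m\rangle>c(\Theta_{\widehat{\mathbf w}})$ for all integers $m\ge1$ and all $j\in[d]$ simultaneously (in particular all $\theta_{j,l}$, $l\ne j$, are irrational). $S(\Theta_{\widehat{\mathbf w}},T)=\sum_{j=1}^d\ \sum_{1\le m\le T}\frac{1}{m\prod_{l\in[d],l\ne j}\langle\theta_{j,l}m\rangle}$. *)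

theory Defs
  imports "HOL-Analysis.Analysis" "HOL-Computational_Algebra.Formal_Power_Series"
begin

text \<open>
  Vectors are of type \<open>real ^ 'n\<close>, so the dimension \<open>d\<close> is \<open>CARD('n)\<close>. The normalised
  vector \<open>w / |w|\<close> (Euclidean norm) is the library's \<open>sgn w\<close>.
\<close>

definition nearest_int_dist :: "real \<Rightarrow> real" where
  "nearest_int_dist u = \<bar>u - of_int (round u)\<bar>"

definition frac_vec :: "real ^ 'n \<Rightarrow> real ^ 'n" where
  "frac_vec u = (\<chi> j. frac (u $ j))"

definition sawtooth_vec :: "real ^ 'n \<Rightarrow> real ^ 'n" where
  "sawtooth_vec u = (\<chi> j. frac (u $ j) - 1 / 2)"

text \<open>The set being counted is finite whenever all \<open>w $ j\<close> are positive.\<close>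

definition lattice_count :: "real \<Rightarrow> real ^ 'n \<Rightarrow> real ^ 'n \<Rightarrow> nat" where
  "lattice_count t w u =
     card {x :: int ^ 'n. (\<forall>j. u $ j < of_int (x $ j)) \<and>
             (\<Sum>j\<in>UNIV. w $ j * of_int (x $ j)) < t + w \<bullet> u}"

definition away_from_ints :: "real \<Rightarrow> (real ^ 'n) set" where
  "away_from_ints \<delta> = {u. \<forall>j. \<delta> \<le> nearest_int_dist (u $ j)}"

text \<open>
  The generating function is a formal power series in \<open>s\<close>. For \<open>w $ j \<noteq> 0\<close> the numerator and
  the denominator \<open>fps_exp (w $ j) - 1\<close> both have subdegree 1, so the quotient is exact.
\<close>

definition multi_bernoulli :: "nat \<Rightarrow> real \<Rightarrow> real ^ 'n \<Rightarrow> real" where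
  "multi_bernoulli k t w =
     fact k * fps_nth
       ((\<Prod>j\<in>UNIV. (fps_const (w $ j) * fps_X * fps_exp (w $ j / 2)) / (fps_exp (w $ j) - 1))
         * fps_exp t) k"

definition leading_term :: "real \<Rightarrow> real ^ 'n \<Rightarrow> real ^ 'n \<Rightarrow> real" where
  "leading_term t w u =
     multi_bernoulli CARD('n) (t + w \<bullet> sawtooth_vec u) w / (fact CARD('n) * (\<Prod>j\<in>UNIV. w $ j))"

definition remainder :: "real \<Rightarrow> real ^ 'n \<Rightarrow> real ^ 'n \<Rightarrow> real" where
  "remainder t w v = real (lattice_count t w v) - leading_term t w v"

text \<open>
  The one-sided limits exist for positive \<open>w\<close>: as functions of \<open>t\<close>, the count is a locally
  finite step function and the leading term is a polynomial.
\<close>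

definition remainder_max :: "real \<Rightarrow> real ^ 'n \<Rightarrow> real ^ 'n \<Rightarrow> real" where
  "remainder_max t w v =
     max \<bar>Lim (at_left t) (\<lambda>s. remainder s w v)\<bar> \<bar>Lim (at_right t) (\<lambda>s. remainder s w v)\<bar>"

text \<open>The supremum is taken in \<open>ereal\<close>, so that an upper bound on it includes its finiteness.\<close>

definition remainder_sup :: "real \<Rightarrow> real \<Rightarrow> real ^ 'n \<Rightarrow> ereal" where
  "remainder_sup \<delta> t w = (SUP u\<in>away_from_ints \<delta>. ereal (remainder_max t w (frac_vec u)))"

definition inclines :: "real ^ 'n \<Rightarrow> real ^ 'n ^ 'n" where
  "inclines w = (\<chi> j l. w $ l / w $ j)"

definition mult_approximable :: "real \<Rightarrow> real ^ 'n ^ 'n \<Rightarrow> bool" where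
  "mult_approximable \<kappa> \<Theta> \<longleftrightarrow>
     (\<exists>c>0. \<forall>m::nat. 1 \<le> m \<longrightarrow>
        (\<forall>j. c < real m powr (1 + \<kappa>) * (\<Prod>l\<in>UNIV - {j}. nearest_int_dist (\<Theta> $ j $ l * real m))))"

definition incline_sum :: "real ^ 'n ^ 'n \<Rightarrow> real \<Rightarrow> real" where
  "incline_sum \<Theta> T =
     (\<Sum>j\<in>UNIV. \<Sum>m | 1 \<le> m \<and> real m \<le> T.
        1 / (real m * (\<Prod>l\<in>UNIV - {j}. nearest_int_dist (\<Theta> $ j $ l * real m))))"

end

theory Submission
  imports Defs
begin

text \<open>
  With \<open>\<tau> = t + w \<bullet> v\<close> the count is the sum of \<open>(\<tau> - w \<bullet> x)\<^sub>+ ^ k\<close> over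
  positive integer vectors \<open>x\<close>, for \<open>k = 0\<close>. For each \<open>k\<close>, the residue at \<open>0\<close> of
  \<open>e ^ (\<tau>s) / (s ^ (k + 1) \<Prod>\<^sub>j (e ^ (w\<^sub>j s) - 1))\<close> is the leading term (or an antiderivative
  of it), and the residues at \<open>2 \<pi> i m / w\<^sub>j\<close> form a Fourier series that converges absolutely
  once \<open>k\<close> exceeds \<open>\<kappa> + 1\<close>. The sum of all residues equals the \<open>k\<close>-th Riesz sum. Instead of
  moving contours, we induct on the set of weights: all three functions satisfy
  \<open>F A \<tau> - F A (\<tau> - w\<^sub>i) = F (A - {i}) (\<tau> - w\<^sub>i)\<close>, so the defect has all the \<open>w\<^sub>i\<close> as periods;
  two incommensurable periods make it constant, and a constant whose antiderivative is periodic is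
  zero. Since the count is monotone in \<open>t\<close>, it lies between \<open>k\<close>-fold difference quotients of
  the \<open>k\<close>-th Riesz sum with step comparable to \<open>1 / T\<close>. The difference operator damps the
  Fourier terms with \<open>m > T ^ (1 + \<epsilon>)\<close> to a bounded total and leaves the others at most
  \<open>S(\<Theta>, T ^ (1 + \<epsilon>))\<close>, while the shift costs \<open>O(t ^ (d - 1) / T)\<close> in the polynomial.
\<close>

section \<open>Fourier series of the second Bernoulli polynomial, and finite differences\<close>

text \<open>The sawtooth series with an explicit rate, uniform away from multiples of
  \<open>2 * pi\<close>: an explicit correction of size \<open>O(1 / n)\<close> cancels the
  Dirichlet kernel in the derivative, and what remains is again \<open>O(1 / n)\<close>.\<close>

lemma sum_sin_bound:
  fixes x \<delta> :: real
  assumes "0 < \<delta>" "\<delta> \<le> x" "x \<le> 2 * pi - \<delta>"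
  shows "\<bar>(\<Sum>m=1..n. sin (real m * x) / real m) - (pi - x) / 2\<bar>
           \<le> (1 / sin (\<delta> / 2) + pi / (sin (\<delta> / 2))\<^sup>2) / (2 * real n + 1)"
proof -
  let ?N = "2 * real n + 1"
  \<comment> \<open>The last summand is the correction: differentiating its cosine gives minus the
    closed form of the kernel. Only the derivative of \<open>1 / sin (y / 2)\<close>
    survives.\<close>
  define q where "q = (\<lambda>y. (\<Sum>m=1..n. sin (real m * y) / real m) + (y - pi) / 2
                     + cos (?N * (y / 2)) / (?N * sin (y / 2)))"
  have \<delta>pi: "\<delta> \<le> pi" using assms by simp
  have s\<delta>: "0 < sin (\<delta> / 2)" using assms by (intro sin_gt_zero) auto
  have s_ge: "sin (\<delta> / 2) \<le> sin (y / 2)" if "\<delta> \<le> y" "y \<le> 2 * pi - \<delta>" for y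
  proof (cases "y \<le> pi")
    case True
    then show ?thesis using that assms by (subst sin_mono_le_eq) auto
  next
    case False
    have "sin (\<delta> / 2) \<le> sin (pi - y / 2)"
      using that assms False \<delta>pi by (subst sin_mono_le_eq) auto
    then show ?thesis by simp
  qed
  have kernel: "2 * sin (y / 2) * ((\<Sum>m=1..n. cos (real m * y)) + 1 / 2) = sin (?N * (y / 2))" for y
  proof (induction n)
    case (Suc n)
    have "2 * sin (y / 2) * cos (real (Suc n) * y)
            = sin ((2 * real (Suc n) + 1) * (y / 2)) - sin ((2 * real n + 1) * (y / 2))"
    proof -
      have *: "(2 * real (Suc n) + 1) * (y / 2) = real (Suc n) * y + y / 2"
        "(2 * real n + 1) * (y / 2) = real (Suc n) * y - y / 2" by (simp_all add: algebra_simps)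
      show ?thesis unfolding * sin_add sin_diff by simp
    qed
    with Suc show ?case by (simp add: distrib_left distrib_right)
  qed simp
  let ?q' = "\<lambda>y. - (cos (?N * (y / 2)) * cos (y / 2) / (2 * ?N * (sin (y / 2))\<^sup>2))"
  have der: "(q has_real_derivative ?q' y) (at y)" if "\<delta> \<le> y" "y \<le> 2 * pi - \<delta>" for y
  proof -
    have s: "sin (y / 2) > 0" using s_ge[OF that] s\<delta> by linarith
    have "((\<lambda>y. \<Sum>m=1..n. sin (real m * y) / real m) has_real_derivative
            (\<Sum>m=1..n. cos (real m * y))) (at y)"
      by (intro DERIV_sum) (auto intro!: derivative_eq_intros)
    moreover have "((\<lambda>y. (y - pi) / 2) has_real_derivative 1 / 2) (at y)"
      by (auto intro!: derivative_eq_intros)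
    moreover have "((\<lambda>y. cos (?N * (y / 2))) has_real_derivative - sin (?N * (y / 2)) * (?N / 2)) (at y)"
      by (auto intro!: derivative_eq_intros)
    moreover have "((\<lambda>y. ?N * sin (y / 2)) has_real_derivative ?N * (cos (y / 2) / 2)) (at y)"
      by (auto intro!: derivative_eq_intros)
    moreover have "?N * sin (y / 2) \<noteq> 0" using s by (simp add: add_eq_0_iff)
    ultimately have "(q has_real_derivative
        ((\<Sum>m=1..n. cos (real m * y)) + 1 / 2
          + (- sin (?N * (y / 2)) * (?N / 2) * (?N * sin (y / 2))
             - cos (?N * (y / 2)) * (?N * (cos (y / 2) / 2))) / (?N * sin (y / 2))\<^sup>2)) (at y)"
      unfolding q_def power2_eq_square by (intro DERIV_add DERIV_divide) auto
    moreover have "(\<Sum>m=1..n. cos (real m * y)) + 1 / 2 = sin (?N * (y / 2)) / (2 * sin (y / 2))"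
      using kernel[of y] s by (simp add: field_simps)
    moreover have "S / (2 * s) + (- S * (N / 2) * (N * s) - C * (N * (c / 2))) / (N * s)\<^sup>2
                     = - (C * c / (2 * N * s\<^sup>2))" if "s > 0" "N > 0" for S s C c N :: real
      using that by (simp add: divide_simps power2_eq_square)
    from this[OF s, of ?N]
    have "sin (?N * (y / 2)) / (2 * sin (y / 2))
          + (- sin (?N * (y / 2)) * (?N / 2) * (?N * sin (y / 2))
             - cos (?N * (y / 2)) * (?N * (cos (y / 2) / 2))) / (?N * sin (y / 2))\<^sup>2 = ?q' y" by simp
    ultimately show ?thesis by simp
  qed
  have bound: "\<bar>?q' y\<bar> \<le> 1 / (2 * ?N * (sin (\<delta> / 2))\<^sup>2)" if "\<delta> \<le> y" "y \<le> 2 * pi - \<delta>" for y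
  proof -
    have "\<bar>cos (?N * (y / 2)) * cos (y / 2)\<bar> \<le> 1 * 1"
      unfolding abs_mult by (intro mult_mono) auto
    moreover have "(sin (\<delta> / 2))\<^sup>2 \<le> (sin (y / 2))\<^sup>2"
      using s_ge[OF that] s\<delta> by (intro power_mono) auto
    ultimately show ?thesis using s\<delta>
      by (simp add: abs_mult) (intro frac_le mult_mono, auto)
  qed
  have q_pi: "q pi = 0"
  proof -
    have "sin (real m * pi) = 0" for m by (simp add: sin_zero_iff_int2)
    moreover have "cos (?N * (pi / 2)) = 0"
    proof -
      have "?N * (pi / 2) = real n * pi + pi / 2" by (simp add: field_simps)
      then show ?thesis by (simp only: cos_add) simp
    qed
    ultimately show ?thesis by (simp add: q_def)
  qed
  have "\<bar>q x\<bar> \<le> 1 / (2 * ?N * (sin (\<delta> / 2))\<^sup>2) * \<bar>x - pi\<bar>"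
  proof -
    have "norm (q x - q pi) \<le> 1 / (2 * ?N * (sin (\<delta> / 2))\<^sup>2) * norm (x - pi)"
    proof (rule field_differentiable_bound[where S = "{\<delta>..2 * pi - \<delta>}"])
      show "(q has_field_derivative ?q' z) (at z within {\<delta>..2 * pi - \<delta>})" if "z \<in> {\<delta>..2 * pi - \<delta>}" for z
        using der[of z] that by (auto intro: has_field_derivative_at_within)
      show "norm (?q' z) \<le> 1 / (2 * ?N * (sin (\<delta> / 2))\<^sup>2)" if "z \<in> {\<delta>..2 * pi - \<delta>}" for z
        using bound[of z] that by simp
    qed (use assms \<delta>pi in auto)
    then show ?thesis using q_pi by simp
  qed
  also have "\<dots> \<le> 1 / (2 * ?N * (sin (\<delta> / 2))\<^sup>2) * (2 * pi)"
    using assms by (intro mult_left_mono) auto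
  also have "\<dots> = pi / (sin (\<delta> / 2))\<^sup>2 / ?N"
  proof -
    have "1 / (2 * N * S) * (2 * pi) = pi / S / N" for N S :: real by simp
    then show ?thesis .
  qed
  finally have 1: "\<bar>q x\<bar> \<le> pi / (sin (\<delta> / 2))\<^sup>2 / ?N" .
  have 2: "\<bar>cos (?N * (x / 2)) / (?N * sin (x / 2))\<bar> \<le> 1 / sin (\<delta> / 2) / ?N"
  proof -
    have "\<bar>cos (?N * (x / 2))\<bar> / (?N * sin (x / 2)) \<le> 1 / (?N * sin (\<delta> / 2))"
      using s_ge[OF assms(2,3)] s\<delta> by (intro frac_le mult_left_mono) auto
    moreover have "\<bar>sin (x / 2)\<bar> = sin (x / 2)" using s_ge[OF assms(2,3)] s\<delta> by simp
    moreover have "\<bar>?N\<bar> = ?N" by simp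
    ultimately show ?thesis by (simp only: abs_divide abs_mult) (simp add: field_simps)
  qed
  have "(\<Sum>m=1..n. sin (real m * x) / real m) - (pi - x) / 2 = q x - cos (?N * (x / 2)) / (?N * sin (x / 2))"
    unfolding q_def by (simp add: field_simps)
  with 1 2 show ?thesis unfolding add_divide_distrib by linarith
qed

lemma summable_inverse_squares_Suc: "summable (\<lambda>m. 1 / (real (Suc m))\<^sup>2)"
  using inverse_squares_sums by (simp add: sums_iff)

text \<open>By \<open>sum_sin_bound\<close> the partial sums minus the quadratic have derivatives
  tending to 0 uniformly inside the period, so the limit is constant there; continuity reaches the
  end points. The value of \<open>C\<close> may stay implicit, since a later periodicity argument
  removes any constant.\<close>

lemma suminf_cos_div_squares:
  "\<exists>C. \<forall>x\<in>{0..2 * pi}. (\<Sum>m. cos (real (Suc m) * x) / (real (Suc m))\<^sup>2) = x\<^sup>2 / 4 - pi * x / 2 + C"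
proof -
  define F where "F = (\<lambda>x. \<Sum>m. cos (real (Suc m) * x) / (real (Suc m))\<^sup>2)"
  define G where "G = (\<lambda>x. F x - (x\<^sup>2 / 4 - pi * x / 2))"
  have le: "norm (cos (real (Suc m) * x) / (real (Suc m))\<^sup>2) \<le> 1 / (real (Suc m))\<^sup>2" for m x
    by (simp add: divide_right_mono)
  have unif: "uniform_limit UNIV (\<lambda>n x. \<Sum>m<n. cos (real (Suc m) * x) / (real (Suc m))\<^sup>2) F sequentially"
    unfolding F_def by (rule Weierstrass_m_test[OF le summable_inverse_squares_Suc])
  have contF: "continuous_on UNIV F"
    by (rule uniform_limit_theorem[OF _ unif]) (intro always_eventually allI continuous_intros, auto)
  have contG: "continuous_on {0..2 * pi} G"
    unfolding G_def by (intro continuous_intros continuous_on_subset[OF contF]) auto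
  have eq: "G x = G pi" if x: "0 < x" "x < 2 * pi" for x
  proof -
    define \<delta> where "\<delta> = min x (2 * pi - x)"
    have \<delta>: "0 < \<delta>" "\<delta> \<le> x" "x \<le> 2 * pi - \<delta>" "\<delta> \<le> pi" using x by (auto simp: \<delta>_def)
    define K where "K = 1 / sin (\<delta> / 2) + pi / (sin (\<delta> / 2))\<^sup>2"
    define g where "g = (\<lambda>n x. (\<Sum>m<n. cos (real (Suc m) * x) / (real (Suc m))\<^sup>2) - (x\<^sup>2 / 4 - pi * x / 2))"
    have tends: "(\<lambda>n. g n y) \<longlonglongrightarrow> G y" for y
      unfolding g_def G_def by (intro tendsto_diff tendsto_const tendsto_uniform_limitI[OF unif]) auto
    have "norm (g n x - g n pi) \<le> K / (2 * real n + 1) * norm (x - pi)" for n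
    proof (rule field_differentiable_bound[where S = "{\<delta>..2 * pi - \<delta>}"])
      fix z assume z: "z \<in> {\<delta>..2 * pi - \<delta>}"
      let ?d = "- ((\<Sum>m=1..n. sin (real m * z) / real m) - (pi - z) / 2)"
      have "(g n has_field_derivative ?d) (at z)"
      proof -
        have tm: "((\<lambda>x. cos (real (Suc m) * x) / (real (Suc m))\<^sup>2) has_field_derivative
            - (sin (real (Suc m) * z) / real (Suc m))) (at z)" for m
        proof -
          have "real (Suc m) > 0" by simp
          then show ?thesis
            by (auto intro!: derivative_eq_intros simp: power2_eq_square simp del: of_nat_Suc)
        qed
        have "((\<lambda>x. x\<^sup>2 / 4 - pi * x / 2) has_field_derivative (z / 2 - pi / 2)) (at z)"
          by (auto intro!: derivative_eq_intros)
        with tm have gd: "(g n has_field_derivative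
            (\<Sum>m<n. - (sin (real (Suc m) * z) / real (Suc m))) - (z / 2 - pi / 2)) (at z)"
          unfolding g_def by (intro DERIV_diff[where g = "\<lambda>x. x\<^sup>2 / 4 - pi * x / 2"] DERIV_sum)
        have se: "(\<Sum>m=1..n. sin (real m * z) / real m) = (\<Sum>m<n. sin (real (Suc m) * z) / real (Suc m))"
          by (rule sum.reindex_bij_witness[of _ Suc "\<lambda>m. m - 1"]) auto
        show ?thesis by (rule DERIV_cong[OF gd]) (simp only: se sum_negf, simp add: diff_divide_distrib)
      qed
      then show "(g n has_field_derivative ?d) (at z within {\<delta>..2 * pi - \<delta>})"
        by (rule has_field_derivative_at_within)
      show "norm ?d \<le> K / (2 * real n + 1)"
        using sum_sin_bound[of \<delta> z n] z \<delta>(1) unfolding K_def by simp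
    qed (use \<delta> in auto)
    then have le: "norm (g n x - g n pi) \<le> K / (2 * real n + 1) * norm (x - pi)" for n .
    have lim0: "(\<lambda>n. K / (2 * real n + 1) * norm (x - pi)) \<longlonglongrightarrow> 0"
    proof -
      have "filterlim (\<lambda>n. 1 + 2 * real n) at_top sequentially"
        by (intro filterlim_tendsto_add_at_top[OF tendsto_const]
            filterlim_tendsto_pos_mult_at_top[OF tendsto_const] filterlim_real_sequentially) simp
      from tendsto_divide_0[OF tendsto_const[of "K * norm (x - pi)"] filterlim_at_top_imp_at_infinity[OF this]]
      have "(\<lambda>n. K * norm (x - pi) / (2 * real n + 1)) \<longlonglongrightarrow> 0"
        by (simp add: add.commute)
      then show ?thesis by simp
    qed
    have "(\<lambda>n. norm (g n x - g n pi)) \<longlonglongrightarrow> norm (G x - G pi)"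
      by (intro tendsto_norm tendsto_diff tends)
    from LIMSEQ_le[OF this lim0] have "norm (G x - G pi) \<le> 0" using le by blast
    then show ?thesis by simp
  qed
  have *: "G x = G pi" if x: "x \<in> {0..2 * pi}" for x
  proof -
    have "x \<in> closure {0<..<2 * pi}" using x by simp
    moreover have "closed {x \<in> {0..2 * pi}. G x = G pi}"
      using continuous_closed_preimage_constant[OF contG, of "G pi"] by simp
    moreover have "{0<..<2 * pi} \<subseteq> {x \<in> {0..2 * pi}. G x = G pi}"
      by (auto intro: eq)
    ultimately show ?thesis using closure_minimal by blast
  qed
  have "F x = x\<^sup>2 / 4 - pi * x / 2 + G pi" if "x \<in> {0..2 * pi}" for x
    using *[OF that] unfolding G_def by linarith
  then show ?thesis unfolding F_def by blast
qed

section \<open>Functions with two incommensurable periods\<close>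

lemma periodic_nat_mult:
  fixes f :: "real \<Rightarrow> 'a"
  assumes "\<And>x. x > 0 \<Longrightarrow> f (x + a) = f x" "a > 0" "x > 0"
  shows "f (x + real n * a) = f x"
proof (induction n)
  case (Suc n)
  have "f (x + real n * a + a) = f (x + real n * a)"
    using assms by (intro assms(1)) (simp add: add_pos_nonneg)
  with Suc show ?case by (simp add: algebra_simps)
qed simp

text \<open>The numbers \<open>x + k * a - h * b\<close> come arbitrarily close to \<open>y\<close>,
  because multiples of \<open>a / b\<close> are dense modulo 1. Periodicity is given at positive
  arguments only, so every intermediate argument must stay positive.\<close>

lemma constant_if_two_irrational_periods:
  fixes f :: "real \<Rightarrow> real"
  assumes cont: "\<And>x. x > 0 \<Longrightarrow> isCont f x"
    and a: "a > 0" "\<And>x. x > 0 \<Longrightarrow> f (x + a) = f x"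
    and b: "b > 0" "\<And>x. x > 0 \<Longrightarrow> f (x + b) = f x"
    and irr: "a / b \<notin> \<rat>"
    and xy: "x > 0" "y > 0"
  shows "f x = f y"
proof -
  have "\<bar>f x - f y\<bar> \<le> \<epsilon>" if "\<epsilon> > 0" for \<epsilon>
  proof -
    obtain \<delta> where \<delta>: "\<delta> > 0" "\<And>z. \<bar>z - y\<bar> < \<delta> \<Longrightarrow> \<bar>f z - f y\<bar> < \<epsilon>"
      using cont[OF xy(2)] \<open>\<epsilon> > 0\<close> unfolding continuous_at_eps_delta by (auto simp: dist_real_def)
    have "min \<delta> y / b > 0" using \<delta>(1) xy b(1) by simp
    from sequence_of_fractional_parts_is_dense[OF irr this, of "(y - x) / b"]
    obtain k h :: int where kh: "k > 0" "\<bar>of_int k * (a / b) - of_int h - (y - x) / b\<bar> < min \<delta> y / b"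
      by blast
    define z where "z = x + of_int k * a - of_int h * b"
    have "of_int k * (a / b) - of_int h - (y - x) / b = (z - y) / b"
      using b(1) by (simp add: z_def field_simps)
    with kh(2) b(1) have z: "\<bar>z - y\<bar> < min \<delta> y" by (simp add: divide_less_cancel)
    then have "z > 0" by linarith
    have p: "0 < x + real (nat k) * a" using xy a(1) by (simp add: add_pos_nonneg)
    have "f x = f (x + real (nat k) * a)"
      using periodic_nat_mult[of f a, OF a(2,1) xy(1)] by simp
    also have "\<dots> = f (x + real (nat k) * a + real (nat (- h)) * b)"
      using periodic_nat_mult[of f b, OF b(2,1) p] by simp
    \<comment> \<open>Upward shifts come first. As \<open>nat\<close> truncates, one of
      \<open>nat h\<close> and \<open>nat (- h)\<close> is 0, so both signs of \<open>h\<close> are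
      covered; the shift down by multiples of \<open>b\<close> ends at the positive point
      \<open>z\<close>.\<close>
    also have "x + real (nat k) * a + real (nat (- h)) * b = z + real (nat h) * b"
      using kh(1) by (cases "h \<ge> 0") (auto simp: z_def)
    also have "f \<dots> = f z"
      using periodic_nat_mult[of f b, OF b(2,1) \<open>z > 0\<close>] .
    finally show ?thesis using \<delta>(2)[of z] z by simp
  qed
  then show ?thesis by (metis abs_le_zero_iff eq_iff_diff_eq_0 field_le_epsilon add_0)
qed

section \<open>Forward differences\<close>

primrec fdiff :: "nat \<Rightarrow> real \<Rightarrow> (real \<Rightarrow> real) \<Rightarrow> real \<Rightarrow> real" where
  "fdiff 0 h f x = f x"
| "fdiff (Suc n) h f x = fdiff n h (\<lambda>y. f (y + h) - f y) x"

text \<open>Forward differences sample only arguments to the right of \<open>x\<close>; this allows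
  differencing the residue formula, which holds for positive arguments.\<close>

lemma fdiff_cong:
  assumes "\<And>y. y \<ge> x \<Longrightarrow> f y = g y" "h \<ge> 0"
  shows "fdiff n h f x = fdiff n h g x"
  using assms(1)
proof (induction n arbitrary: f g)
  case (Suc n)
  have "fdiff n h (\<lambda>y. f (y + h) - f y) x = fdiff n h (\<lambda>y. g (y + h) - g y) x"
    by (rule Suc.IH) (use Suc.prems assms(2) in auto)
  then show ?case by simp
qed simp

lemma fdiff_add: "fdiff n h (\<lambda>x. f x + g x) x = fdiff n h f x + fdiff n h g x"
proof (induction n arbitrary: f g)
  case (Suc n)
  have "(\<lambda>y. f (y + h) + g (y + h) - (f y + g y)) = (\<lambda>y. (f (y + h) - f y) + (g (y + h) - g y))" by auto
  with Suc[of "\<lambda>y. f (y + h) - f y" "\<lambda>y. g (y + h) - g y"] show ?case by simp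
qed simp

text \<open>One mean value step per difference: \<open>n\<close> differences undo \<open>n\<close>
  integrations up to the factor \<open>h ^ n\<close> and a displacement of at most
  \<open>n * h\<close>.\<close>

lemma fdiff_mean_value:
  fixes F :: "nat \<Rightarrow> real \<Rightarrow> real"
  assumes "\<And>i x. (F (Suc i) has_real_derivative F i x) (at x)" "h > 0"
  shows "\<exists>\<xi>. x \<le> \<xi> \<and> \<xi> \<le> x + real n * h \<and> fdiff n h (F n) x = h ^ n * F 0 \<xi>"
  using assms(1)
proof (induction n arbitrary: F)
  case (Suc n)
  \<comment> \<open>A new chain of antiderivatives whose bottom is a difference of
    \<open>F 1\<close>; after the induction hypothesis, one more mean value step turns that bottom
    into \<open>F 0\<close>.\<close>
  define G where "G = (\<lambda>i x. F (Suc i) (x + h) - F (Suc i) x)"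
  have "(G (Suc i) has_real_derivative G i x) (at x)" for i x
    unfolding G_def by (intro DERIV_diff Suc.prems) (simp add: DERIV_shift[symmetric] Suc.prems)
  then obtain \<xi> where \<xi>: "x \<le> \<xi>" "\<xi> \<le> x + real n * h" "fdiff n h (G n) x = h ^ n * G 0 \<xi>"
    using Suc.IH by blast
  obtain \<eta> where "\<xi> < \<eta>" "\<eta> < \<xi> + h" "F 1 (\<xi> + h) - F 1 \<xi> = (\<xi> + h - \<xi>) * F 0 \<eta>"
    using MVT2[of \<xi> "\<xi> + h" "F 1" "F 0"] Suc.prems[of 0] assms(2) by auto
  with \<xi> show ?case
    by (intro exI[of _ \<eta>]) (auto simp: G_def algebra_simps)
qed auto

section \<open>Riesz sums and residue sums\<close>

text \<open>Division by \<open>fact k\<close> makes each level from 1 on the derivative of the next.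
  Level 0 is the indicator of \<open>x > 0\<close>, strict like the inequality in the count.\<close>

definition trunc_power :: "nat \<Rightarrow> real \<Rightarrow> real" where
  "trunc_power k x = (if x > 0 then x ^ k / fact k else 0)"

lemma DERIV_power_div_fact:
  "((\<lambda>x. x ^ Suc k / fact (Suc k)) has_real_derivative x ^ k / fact k) (at x)"
proof -
  have "real (Suc k) * x ^ (Suc k - Suc 0) / fact (Suc k) = x ^ k / fact k"
    by (simp only: fact_Suc diff_Suc_Suc diff_zero) (simp del: of_nat_Suc)
  then show ?thesis
    using DERIV_cdivide[OF DERIV_pow[of "Suc k" x UNIV], of "fact (Suc k)"] by (simp only:)
qed

text \<open>The delicate point is 0, where the difference quotient is at most
  \<open>\<bar>h\<bar> ^ k\<close>, which tends to 0 as \<open>k \<ge> 1\<close>.\<close>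

lemma DERIV_trunc_power:
  assumes "k \<ge> 1"
  shows "(trunc_power (Suc k) has_real_derivative trunc_power k x) (at x)"
proof -
  consider "x > 0" | "x < 0" | "x = 0" by linarith
  then show ?thesis
  proof cases
    case 1
    show ?thesis
      using 1 DERIV_power_div_fact[of k x] by (auto intro: has_field_derivative_transform_within_open[of _ _ _ "{0<..}"] simp: trunc_power_def)
  next
    case 2
    have "(trunc_power (Suc k) has_real_derivative 0) (at x)"
      by (rule has_field_derivative_transform_within_open[of "\<lambda>x. 0" _ _ "{..<0}"])
         (use 2 in \<open>auto simp: trunc_power_def\<close>)
    with 2 show ?thesis by (simp add: trunc_power_def)
  next
    case 3
    have "((\<lambda>h. trunc_power (Suc k) h / h) \<longlongrightarrow> 0) (at 0)"
    proof (rule Lim_null_comparison)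
      show "\<forall>\<^sub>F h in at 0. norm (trunc_power (Suc k) h / h) \<le> \<bar>h\<bar> ^ k"
      proof (intro always_eventually allI)
        fix h :: real
        have "\<bar>h\<bar> ^ k / fact (Suc k) \<le> \<bar>h\<bar> ^ k / 1"
          by (intro divide_left_mono fact_ge_1) auto
        then show "norm (trunc_power (Suc k) h / h) \<le> \<bar>h\<bar> ^ k"
          by (auto simp: trunc_power_def abs_mult power_abs simp del: fact_Suc)
      qed
      have "((\<lambda>h::real. \<bar>h\<bar> ^ k) \<longlongrightarrow> \<bar>0\<bar> ^ k) (at 0)" by (intro tendsto_intros)
      then show "((\<lambda>h::real. \<bar>h\<bar> ^ k) \<longlongrightarrow> 0) (at 0)" using assms by (simp add: power_0_left)
    qed
    with 3 show ?thesis by (simp add: DERIV_def trunc_power_def)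
  qed
qed

text \<open>Differentiating \<open>e ^ (x s)\<close> in \<open>x\<close> multiplies by
  \<open>s\<close>, which lowers the coefficient index by one.\<close>

lemma DERIV_fps_nth_mult_exp:
  fixes B :: "real fps"
  shows "((\<lambda>x. fps_nth (B * fps_exp x) (Suc n)) has_real_derivative fps_nth (B * fps_exp x) n) (at x)"
proof -
  have "((\<lambda>x. \<Sum>i=0..n. fps_nth B i * (x ^ (Suc n - i) / fact (Suc n - i))) has_real_derivative
          (\<Sum>i=0..n. fps_nth B i * (x ^ (n - i) / fact (n - i)))) (at x)"
  proof (intro DERIV_sum)
    fix i assume "i \<in> {0..n}"
    then have i: "Suc n - i = Suc (n - i)" by auto
    show "((\<lambda>x. fps_nth B i * (x ^ (Suc n - i) / fact (Suc n - i))) has_real_derivative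
             fps_nth B i * (x ^ (n - i) / fact (n - i))) (at x)"
      unfolding i by (intro DERIV_cmult DERIV_power_div_fact)
  qed
  from DERIV_add[OF this DERIV_const[of "fps_nth B (Suc n)"]]
  show ?thesis by (simp add: fps_mult_nth)
qed

section \<open>Riesz sums over positive integer points\<close>

locale incommensurable_weights =
  fixes w :: "'n::finite \<Rightarrow> real"
  assumes w_pos: "w j > 0"
    and irrational_ratio: "l \<noteq> j \<Longrightarrow> w l / w j \<notin> \<rat>"
begin

definition wsum :: "'n set \<Rightarrow> ('n \<Rightarrow> nat) \<Rightarrow> real" where
  "wsum A x = (\<Sum>j\<in>A. w j * real (x j))"

text \<open>The set \<open>A\<close> of active weights varies because the residue formula is proved
  by induction on it. Extensional functions retain just the coordinates in \<open>A\<close>.\<close>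

definition points :: "'n set \<Rightarrow> real \<Rightarrow> ('n \<Rightarrow> nat) set" where
  "points A t = {x \<in> PiE A (\<lambda>_. {1..}). wsum A x < t}"

definition riesz_sum :: "'n set \<Rightarrow> nat \<Rightarrow> real \<Rightarrow> real" where
  "riesz_sum A k t = (\<Sum>x\<in>points A t. trunc_power k (t - wsum A x))"

lemma finite_points: "finite (points A t)"
proof (rule finite_subset)
  show "points A t \<subseteq> PiE A (\<lambda>j. {..nat \<lceil>t / w j\<rceil>})"
  proof
    fix x assume x: "x \<in> points A t"
    have "x j \<le> nat \<lceil>t / w j\<rceil>" if "j \<in> A" for j
    proof -
      have "w j * real (x j) \<le> wsum A x"
        unfolding wsum_def using that by (intro member_le_sum) (auto intro!: mult_nonneg_nonneg less_imp_le[OF w_pos])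
      also have "\<dots> < t" using x by (simp add: points_def)
      finally have "real (x j) < t / w j" using w_pos[of j] by (simp add: field_simps)
      then show ?thesis by linarith
    qed
    with x show "x \<in> PiE A (\<lambda>j. {..nat \<lceil>t / w j\<rceil>})" by (auto simp: points_def PiE_iff)
  qed
qed (auto intro: finite_PiE)

lemma points_mono: "s \<le> t \<Longrightarrow> points A s \<subseteq> points A t"
  by (auto simp: points_def)

text \<open>The extra points contribute 0 by truncation. A fixed finite index set allows termwise
  derivatives and limits.\<close>

lemma riesz_sum_eq_sum:
  assumes "s \<le> t"
  shows "riesz_sum A k s = (\<Sum>x\<in>points A t. trunc_power k (s - wsum A x))"
  unfolding riesz_sum_def using points_mono[OF assms] finite_points
  by (intro sum.mono_neutral_left) (auto simp: points_def trunc_power_def)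

lemma riesz_sum_0: "riesz_sum A 0 t = real (card (points A t))"
  by (simp add: riesz_sum_def trunc_power_def points_def)

lemma riesz_sum_0_mono: "s \<le> t \<Longrightarrow> riesz_sum A 0 s \<le> riesz_sum A 0 t"
  by (simp add: riesz_sum_0 card_mono finite_points points_mono)

lemma DERIV_riesz_sum:
  assumes "k \<ge> 1"
  shows "(riesz_sum A (Suc k) has_real_derivative riesz_sum A k t) (at t)"
proof (rule has_field_derivative_transform_within_open[where S = "{..<t + 1}"])
  have "((\<lambda>s. trunc_power (Suc k) (s - c)) has_real_derivative trunc_power k (t - c)) (at t)" for c
    using DERIV_trunc_power[OF assms, of "t + (- c)"] unfolding DERIV_shift by simp
  then show "((\<lambda>s. \<Sum>x\<in>points A (t + 1). trunc_power (Suc k) (s - wsum A x)) has_real_derivative riesz_sum A k t) (at t)"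
    by (subst riesz_sum_eq_sum[of t "t + 1"]) (auto intro: DERIV_sum)
  show "(\<Sum>x\<in>points A (t + 1). trunc_power (Suc k) (s - wsum A x)) = riesz_sum A (Suc k) s" if "s \<in> {..<t + 1}" for s
    using that by (subst riesz_sum_eq_sum[of s "t + 1"]) auto
qed auto

text \<open>The difference is the integral of the nondecreasing count over an interval of length
  \<open>h\<close>. As the count jumps, terms are compared one by one instead of using a mean value
  theorem.\<close>

lemma riesz_sum_1_diff_bounds:
  assumes "h > 0"
  shows "h * riesz_sum A 0 t \<le> riesz_sum A 1 (t + h) - riesz_sum A 1 t" "riesz_sum A 1 (t + h) - riesz_sum A 1 t \<le> h * riesz_sum A 0 (t + h)"
proof -
  have eq: "riesz_sum A 1 (t + h) - riesz_sum A 1 t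
          = (\<Sum>x\<in>points A (t + h). trunc_power 1 (t + h - wsum A x) - trunc_power 1 (t - wsum A x))"
    using assms riesz_sum_eq_sum[of "t + h" "t + h" A 1] riesz_sum_eq_sum[of t "t + h" A 1] by (simp add: sum_subtractf)
  have "h * riesz_sum A 0 t = (\<Sum>x\<in>points A (t + h). h * trunc_power 0 (t - wsum A x))"
    using assms by (simp add: riesz_sum_eq_sum[of t "t + h"] sum_distrib_left)
  also have "\<dots> \<le> riesz_sum A 1 (t + h) - riesz_sum A 1 t"
    unfolding eq using assms by (intro sum_mono) (auto simp: trunc_power_def)
  finally show "h * riesz_sum A 0 t \<le> riesz_sum A 1 (t + h) - riesz_sum A 1 t" .
  show "riesz_sum A 1 (t + h) - riesz_sum A 1 t \<le> h * riesz_sum A 0 (t + h)"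
    unfolding eq riesz_sum_def[of A 0] sum_distrib_left using assms
    by (intro sum_mono) (auto simp: trunc_power_def)
qed

lemma wsum_upd:
  assumes "j \<in> A"
  shows "wsum A (x(j := n)) = wsum (A - {j}) x + w j * real n"
  unfolding wsum_def using assms by (subst sum.remove[of A j]) (auto intro!: sum.cong)

text \<open>A point with \<open>x j \<ge> 2\<close> yields, by lowering that coordinate, a point for
  \<open>t - w j\<close>; a point with \<open>x j = 1\<close> yields, by forgetting it, a point for
  \<open>A - {j}\<close>. In generating functions this cancels one factor
  \<open>e ^ (w j * s) - 1\<close>.\<close>

lemma riesz_sum_shift:
  assumes "j \<in> A"
  shows "riesz_sum A k t - riesz_sum A k (t - w j) = riesz_sum (A - {j}) k (t - w j)"
proof -
  let ?S = "(\<lambda>x. x(j := Suc (x j))) ` points A (t - w j)"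
  let ?I = "(\<lambda>x. x(j := 1)) ` points (A - {j}) (t - w j)"
  have split: "wsum A x = wsum (A - {j}) x + w j * real (x j)" for x
    using wsum_upd[OF assms, of x "x j"] by simp
  have dec: "y \<in> ?S \<union> ?I" if y: "y \<in> points A t" for y
  proof -
    have yP: "y \<in> PiE A (\<lambda>_. {1..})" and yt: "wsum A y < t" using y by (auto simp: points_def)
    then have yj: "y j \<ge> 1" using assms by auto
    show ?thesis
    proof (cases "y j = 1")
      case True
      \<comment> \<open>\<open>undefined\<close> is the value of an extensional function off its
        domain, so this is the restriction of \<open>y\<close> to \<open>A - {j}\<close>.\<close>
      let ?x = "y(j := undefined)"
      have "wsum (A - {j}) ?x = wsum (A - {j}) y" unfolding wsum_def by (intro sum.cong) auto
      then have "?x \<in> points (A - {j}) (t - w j)"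
        using yP yt True split[of y] by (auto simp: points_def PiE_iff extensional_def)
      moreover have "y = ?x(j := 1)" using True by auto
      ultimately show ?thesis by blast
    next
      case False
      let ?x = "y(j := y j - 1)"
      have "wsum A ?x = wsum A y - w j"
        using yj by (simp add: wsum_upd[OF assms] split[of y] of_nat_diff algebra_simps)
      then have "?x \<in> points A (t - w j)"
        using yP yt False yj assms by (auto simp: points_def PiE_iff extensional_def)
      moreover have "y = ?x(j := Suc (?x j))" using yj by auto
      ultimately show ?thesis by blast
    qed
  qed
  have Sj: "wsum A (x(j := Suc (x j))) = wsum A x + w j" for x
    by (simp add: wsum_upd[OF assms] split[of x] algebra_simps)
  have Ij: "wsum A (x(j := 1)) = wsum (A - {j}) x + w j" for x
    by (simp add: wsum_upd[OF assms])
  have eq: "points A t = ?S \<union> ?I"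
  proof
    show "?S \<union> ?I \<subseteq> points A t"
      using assms by (auto simp: points_def Sj Ij[unfolded One_nat_def] PiE_iff extensional_def)
  qed (use dec in blast)
  have disj: "?S \<inter> ?I = {}"
  proof -
    have "x j \<ge> 1" if "x \<in> points A (t - w j)" for x using that assms by (auto simp: points_def)
    then show ?thesis by (force dest: fun_cong[of _ _ j])
  qed
  have inj_S: "inj_on (\<lambda>x. x(j := Suc (x j))) (points A (t - w j))"
    by (rule inj_on_inverseI[where g = "\<lambda>x. x(j := x j - 1)"]) auto
  have inj_I: "inj_on (\<lambda>x. x(j := 1)) (points (A - {j}) (t - w j))"
    by (rule inj_on_inverseI[where g = "\<lambda>x. x(j := undefined)"])
       (auto simp: points_def PiE_iff extensional_def)
  have "riesz_sum A k t = (\<Sum>x\<in>?S. trunc_power k (t - wsum A x)) + (\<Sum>x\<in>?I. trunc_power k (t - wsum A x))"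
    unfolding riesz_sum_def eq by (intro sum.union_disjoint disj finite_imageI finite_points)
  also have "(\<Sum>x\<in>?S. trunc_power k (t - wsum A x)) = riesz_sum A k (t - w j)"
    unfolding riesz_sum_def sum.reindex[OF inj_S] o_def Sj by (simp add: algebra_simps)
  also have "(\<Sum>x\<in>?I. trunc_power k (t - wsum A x)) = riesz_sum (A - {j}) k (t - w j)"
    unfolding riesz_sum_def sum.reindex[OF inj_I] o_def Ij by (simp add: algebra_simps)
  finally show ?thesis by simp
qed

section \<open>The residue at the origin\<close>

definition todd :: "'n \<Rightarrow> real fps" where
  "todd j = fps_X / (fps_exp (w j) - 1)"

lemma fps_exp_dvd_X: "(fps_exp (w j) - 1) dvd (fps_X :: real fps)"
proof -
  have "subdegree (fps_exp (w j) - 1) = 1"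
    using w_pos[of j] by (intro subdegreeI) auto
  moreover have "fps_exp (w j) - 1 \<noteq> 0" using w_pos[of j] by (metis eq_iff_diff_eq_0 fps_exp_eq_1_iff less_irrefl)
  ultimately show ?thesis by (simp add: fps_dvd_iff)
qed

lemma todd_mult: "todd j * (fps_exp (w j) - 1) = fps_X"
  unfolding todd_def using fps_exp_dvd_X by simp

text \<open>The residue at 0. Each factor \<open>todd j\<close> carries one extra power of
  \<open>s\<close>, which moves the index from \<open>k\<close> to
  \<open>k + card A\<close>.\<close>

definition todd_poly :: "'n set \<Rightarrow> nat \<Rightarrow> real \<Rightarrow> real" where
  "todd_poly A k t = fps_nth ((\<Prod>j\<in>A. todd j) * fps_exp t) (k + card A)"

lemma DERIV_todd_poly: "(todd_poly A (Suc k) has_real_derivative todd_poly A k t) (at t)"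
  unfolding todd_poly_def using DERIV_fps_nth_mult_exp by simp

text \<open>The difference of the exponentials contains the factor \<open>e ^ (w j * s) - 1\<close>,
  which turns \<open>todd j\<close> into \<open>s\<close>; this power of \<open>s\<close> matches
  the smaller cardinality of \<open>A - {j}\<close>.\<close>

lemma todd_poly_shift:
  assumes "j \<in> A"
  shows "todd_poly A k t - todd_poly A k (t - w j) = todd_poly (A - {j}) k (t - w j)"
proof -
  have "finite A" by simp
  have c: "card A = Suc (card (A - {j}))" using assms by (metis \<open>finite A\<close> card.remove)
  have e: "fps_exp t = fps_exp (t - w j) * fps_exp (w j)"
    using fps_exp_add_mult[of "t - w j" "w j"] by simp
  have p: "(\<Prod>i\<in>A. todd i) = todd j * (\<Prod>i\<in>A - {j}. todd i)"
    using assms by (simp add: prod.remove)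
  have "(\<Prod>i\<in>A. todd i) * fps_exp t - (\<Prod>i\<in>A. todd i) * fps_exp (t - w j)
          = (todd j * (fps_exp (w j) - 1)) * ((\<Prod>i\<in>A - {j}. todd i) * fps_exp (t - w j))"
    unfolding p e by (simp add: algebra_simps)
  also have "\<dots> = fps_X * ((\<Prod>i\<in>A - {j}. todd i) * fps_exp (t - w j))"
    by (simp only: todd_mult)
  finally show ?thesis
    unfolding todd_poly_def c by (simp flip: fps_sub_nth)
qed

text \<open>
  \<open>\<i> freq j m\<close> is the pole \<open>2 \<pi> \<i> (m + 1) / w\<^sub>j\<close>, indexed from \<open>m = 0\<close>; together with its
  conjugate it contributes twice a real part, and \<open>coef\<close> below is the residue there without the
  exponential factor.
\<close>

definition freq :: "'n \<Rightarrow> nat \<Rightarrow> real" where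
  "freq j m = 2 * pi * real (Suc m) / w j"

lemma freq_pos: "freq j m > 0"
  using w_pos[of j] by (simp add: freq_def)

section \<open>Fourier series at the frequencies of the poles\<close>

definition fourier :: "'n set \<Rightarrow> ('n \<Rightarrow> nat \<Rightarrow> complex) \<Rightarrow> real \<Rightarrow> real" where
  "fourier A a t = (\<Sum>j\<in>A. \<Sum>m. 2 * Re (exp (\<i> * of_real (t * freq j m)) * a j m))"

definition abs_conv :: "'n set \<Rightarrow> ('n \<Rightarrow> nat \<Rightarrow> complex) \<Rightarrow> bool" where
  "abs_conv A a \<longleftrightarrow> (\<forall>j\<in>A. summable (\<lambda>m. norm (a j m)))"

lemma fourier_term_bound: "\<bar>2 * Re (exp (\<i> * of_real x) * a)\<bar> \<le> 2 * norm a"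
  using abs_Re_le_cmod[of "exp (\<i> * of_real x) * a"] by (simp add: norm_mult abs_mult)

lemma fourier_summable:
  assumes "abs_conv A a" "j \<in> A"
  shows "summable (\<lambda>m. 2 * Re (exp (\<i> * of_real (t * freq j m)) * a j m))"
proof (rule summable_comparison_test')
  show "summable (\<lambda>m. 2 * norm (a j m))"
    using assms by (intro summable_mult) (simp add: abs_conv_def)
  show "norm (2 * Re (exp (\<i> * of_real (t * freq j m)) * a j m)) \<le> 2 * norm (a j m)" if "m \<ge> 0" for m
    using fourier_term_bound by (simp only: real_norm_def)
qed

lemma fourier_bound:
  assumes "abs_conv A a"
  shows "\<bar>fourier A a t\<bar> \<le> (\<Sum>j\<in>A. \<Sum>m. 2 * norm (a j m))"
proof -
  have "\<bar>\<Sum>m. 2 * Re (exp (\<i> * of_real (t * freq j m)) * a j m)\<bar> \<le> (\<Sum>m. 2 * norm (a j m))"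
    if "j \<in> A" for j
  proof -
    have s: "summable (\<lambda>m. 2 * norm (a j m))"
      using assms that by (intro summable_mult) (simp add: abs_conv_def)
    have s': "summable (\<lambda>m. \<bar>2 * Re (exp (\<i> * of_real (t * freq j m)) * a j m)\<bar>)"
      by (rule summable_comparison_test'[OF s, of 0]) (use fourier_term_bound in \<open>simp only: real_norm_def abs_abs\<close>)
    show ?thesis
      using summable_rabs[OF s'] suminf_le[OF fourier_term_bound s' s] by linarith
  qed
  then show ?thesis
    unfolding fourier_def by (intro order.trans[OF sum_abs] sum_mono)
qed

text \<open>Translation acts diagonally on exponentials. Used with \<open>h\<close> a weight for the
  shift identity and with small \<open>h\<close> for smoothing.\<close>

lemma fourier_diff_shift:
  assumes "abs_conv A a"
  shows "fourier A a (t + h) - fourier A a t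
           = fourier A (\<lambda>j m. (exp (\<i> * of_real (h * freq j m)) - 1) * a j m) t"
proof -
  have "(\<Sum>m. 2 * Re (exp (\<i> * of_real ((t + h) * freq j m)) * a j m))
          - (\<Sum>m. 2 * Re (exp (\<i> * of_real (t * freq j m)) * a j m))
        = (\<Sum>m. 2 * Re (exp (\<i> * of_real (t * freq j m)) * ((exp (\<i> * of_real (h * freq j m)) - 1) * a j m)))"
    if "j \<in> A" for j
  proof (subst suminf_diff)
    show "(\<Sum>m. 2 * Re (exp (\<i> * of_real ((t + h) * freq j m)) * a j m)
               - 2 * Re (exp (\<i> * of_real (t * freq j m)) * a j m))
        = (\<Sum>m. 2 * Re (exp (\<i> * of_real (t * freq j m)) * ((exp (\<i> * of_real (h * freq j m)) - 1) * a j m)))"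
    proof (rule suminf_cong)
      fix m
      have "exp (\<i> * of_real ((t + h) * freq j m)) = exp (\<i> * of_real (t * freq j m)) * exp (\<i> * of_real (h * freq j m))"
        by (simp add: exp_add[symmetric] algebra_simps)
      then show "2 * Re (exp (\<i> * of_real ((t + h) * freq j m)) * a j m)
               - 2 * Re (exp (\<i> * of_real (t * freq j m)) * a j m)
        = 2 * Re (exp (\<i> * of_real (t * freq j m)) * ((exp (\<i> * of_real (h * freq j m)) - 1) * a j m))"
        by (simp only:) (simp add: algebra_simps)
    qed
  qed (rule fourier_summable[OF assms that])+
  then show ?thesis
    unfolding fourier_def by (simp flip: sum_subtractf)
qed

lemma DERIV_fourier:
  assumes "abs_conv A a" "abs_conv A (\<lambda>j m. \<i> * freq j m * a j m)"
  shows "(fourier A a has_real_derivative fourier A (\<lambda>j m. \<i> * freq j m * a j m) t) (at t)"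
  unfolding fourier_def
proof (rule DERIV_sum)
  fix j assume j: "j \<in> A"
  let ?f = "\<lambda>m t. 2 * Re (exp (\<i> * of_real (t * freq j m)) * a j m)"
  let ?f' = "\<lambda>m t. 2 * Re (exp (\<i> * of_real (t * freq j m)) * (\<i> * freq j m * a j m))"
  show "((\<lambda>t. \<Sum>m. ?f m t) has_real_derivative (\<Sum>m. ?f' m t)) (at t)"
  proof (rule has_field_derivative_series'(2)[of UNIV _ _ 0])
    fix m x
    have "((\<lambda>x. exp (\<i> * of_real (x * freq j m)) * a j m) has_vector_derivative
             exp (\<i> * of_real (x * freq j m)) * (\<i> * freq j m * a j m)) (at x)"
    proof -
      have "((\<lambda>z. exp (\<i> * (z * of_real (freq j m))) * a j m) has_field_derivative
               exp (\<i> * (of_real x * of_real (freq j m))) * (\<i> * freq j m * a j m)) (at (of_real x))"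
        by (auto intro!: derivative_eq_intros)
      from has_vector_derivative_real_field[OF this] show ?thesis by simp
    qed
    from bounded_linear.has_vector_derivative[OF bounded_linear_Re this]
    have "((\<lambda>x. Re (exp (\<i> * of_real (x * freq j m)) * a j m)) has_real_derivative
             Re (exp (\<i> * of_real (x * freq j m)) * (\<i> * freq j m * a j m))) (at x)"
      by (simp only: has_real_derivative_iff_has_vector_derivative)
    from DERIV_cmult[OF this, of 2]
    show "(?f m has_real_derivative ?f' m x) (at x within UNIV)" .
  next
    show "uniformly_convergent_on UNIV (\<lambda>n x. \<Sum>i<n. ?f' i x)"
    proof (rule Weierstrass_m_test'_ev[OF always_eventually])
      show "summable (\<lambda>m. 2 * norm (\<i> * freq j m * a j m))"
        using assms(2) j by (intro summable_mult) (simp add: abs_conv_def)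
      show "\<forall>m. \<forall>x\<in>UNIV. norm (?f' m x) \<le> 2 * norm (\<i> * freq j m * a j m)"
        using fourier_term_bound by (simp only: real_norm_def) blast
    qed
  next
    show "summable (\<lambda>m. ?f m 0)" by (rule fourier_summable[OF assms(1) j])
  qed auto
qed

section \<open>The series of residues at the nonzero poles\<close>

definition coef :: "'n set \<Rightarrow> nat \<Rightarrow> 'n \<Rightarrow> nat \<Rightarrow> complex" where
  "coef A k j m = (\<Prod>l\<in>A - {j}. 1 / (exp (\<i> * of_real (w l * freq j m)) - 1))
                    / (of_real (w j) * (\<i> * of_real (freq j m)) ^ Suc k)"

definition pole_series :: "'n set \<Rightarrow> nat \<Rightarrow> real \<Rightarrow> real" where
  "pole_series A k = fourier A (coef A k)"

lemma exp_eq_1_iff_int: "exp (\<i> * of_real (2 * pi * x)) = (1 :: complex) \<longleftrightarrow> x \<in> \<int>"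
  by (auto simp: exp_eq_1 Ints_def)

lemma exp_w_freq_self: "exp (\<i> * of_real (w j * freq j m)) = (1 :: complex)"
proof -
  have "w j * freq j m = 2 * pi * real (Suc m)" using w_pos[of j] by (simp add: freq_def)
  then show ?thesis using exp_eq_1_iff_int[of "real (Suc m)"] by simp
qed

text \<open>A nonzero pole common to two indices would make their ratio rational; hence no
  denominator in \<open>coef\<close> vanishes.\<close>

lemma exp_w_freq_other:
  assumes "l \<noteq> j"
  shows "exp (\<i> * of_real (w l * freq j m)) \<noteq> (1 :: complex)"
proof
  assume *: "exp (\<i> * of_real (w l * freq j m)) = (1 :: complex)"
  have e: "w l * freq j m = 2 * pi * (real (Suc m) * (w l / w j))" by (simp add: freq_def)
  from * have "real (Suc m) * (w l / w j) \<in> \<int>" unfolding e exp_eq_1_iff_int .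
  then have "real (Suc m) * (w l / w j) / real (Suc m) \<in> \<rat>"
    using Ints_subset_Rats by (intro Rats_divide) auto
  then show False using irrational_ratio[OF assms] by (simp del: of_nat_Suc)
qed

lemma freq_mult_coef: "\<i> * of_real (freq j m) * coef A (Suc k) j m = coef A k j m"
  using freq_pos[of j m] by (simp add: coef_def)

lemma abs_conv_coef_Suc:
  assumes "abs_conv A (coef A k)"
  shows "abs_conv A (coef A (Suc k))"
  unfolding abs_conv_def
proof
  fix j assume "j \<in> A"
  show "summable (\<lambda>m. norm (coef A (Suc k) j m))"
  proof (rule summable_comparison_test')
    show "summable (\<lambda>m. norm (coef A k j m) * (w j / (2 * pi)))"
      using assms \<open>j \<in> A\<close> by (intro summable_mult2) (simp add: abs_conv_def)
    show "norm (norm (coef A (Suc k) j m)) \<le> norm (coef A k j m) * (w j / (2 * pi))" if "m \<ge> 0" for m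
    proof -
      have "1 * norm (coef A (Suc k) j m) \<le> (freq j m * (w j / (2 * pi))) * norm (coef A (Suc k) j m)"
        by (intro mult_right_mono) (use w_pos[of j] in \<open>simp_all add: freq_def\<close>)
      also have "\<dots> = norm (\<i> * of_real (freq j m) * coef A (Suc k) j m) * (w j / (2 * pi))"
        using freq_pos[of j m] by (simp add: norm_mult)
      finally show ?thesis unfolding freq_mult_coef by simp
    qed
  qed
qed

lemma DERIV_pole_series:
  assumes "abs_conv A (coef A k)"
  shows "(pole_series A (Suc k) has_real_derivative pole_series A k t) (at t)"
  unfolding pole_series_def
  using DERIV_fourier[OF abs_conv_coef_Suc[OF assms]] assms by (simp add: freq_mult_coef)

text \<open>The multiplier \<open>e ^ (\<i> * w i * freq j m) - 1\<close> is 0 for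
  \<open>j = i\<close>, which removes the index \<open>i\<close>; for \<open>j \<noteq> i\<close> it
  cancels the factor \<open>l = i\<close> in \<open>coef\<close>.\<close>

lemma pole_series_shift:
  assumes "i \<in> A" "abs_conv A (coef A k)"
  shows "pole_series A k t - pole_series A k (t - w i) = pole_series (A - {i}) k (t - w i)"
proof -
  let ?a = "\<lambda>j m. (exp (\<i> * of_real (w i * freq j m)) - 1) * coef A k j m"
  have "pole_series A k t - pole_series A k (t - w i) = fourier A ?a (t - w i)"
    unfolding pole_series_def using fourier_diff_shift[OF assms(2), of "t - w i" "w i"] by simp
  also have "\<dots> = fourier (A - {i}) ?a (t - w i)"
    unfolding fourier_def using assms(1) by (simp add: sum.remove[of A i] exp_w_freq_self del: of_real_mult)
  also have "\<dots> = pole_series (A - {i}) k (t - w i)"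
  proof -
    have "?a j m = coef (A - {i}) k j m" if "j \<in> A - {i}" for j m
    proof -
      have "A - {j} = insert i (A - {i} - {j})" using that assms(1) by auto
      moreover have "exp (\<i> * of_real (w i * freq j m)) - 1 \<noteq> (0 :: complex)"
        using exp_w_freq_other[of i j m] that by auto
      ultimately show ?thesis unfolding coef_def by simp
    qed
    then show ?thesis unfolding pole_series_def fourier_def by simp
  qed
  finally show ?thesis .
qed

end

section \<open>The residue formula\<close>

context incommensurable_weights
begin

definition defect :: "'n set \<Rightarrow> nat \<Rightarrow> real \<Rightarrow> real" where
  "defect A k t = riesz_sum A k t - todd_poly A k t - pole_series A k t"

lemma defect_shift:
  assumes "i \<in> A" "abs_conv A (coef A k)"
  shows "defect A k t - defect A k (t - w i) = defect (A - {i}) k (t - w i)"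
  unfolding defect_def using riesz_sum_shift[OF assms(1), of k t] todd_poly_shift[OF assms(1), of k t] pole_series_shift[OF assms, of t]
  by linarith

lemma DERIV_defect:
  assumes "k \<ge> 1" "abs_conv A (coef A k)"
  shows "(defect A (Suc k) has_real_derivative defect A k t) (at t)"
  unfolding defect_def by (intro DERIV_diff DERIV_riesz_sum DERIV_todd_poly DERIV_pole_series assms)

text \<open>One empty point remains, and both main terms equal \<open>t ^ k / fact k\<close>. For
  negative \<open>t\<close> truncation breaks the identity, hence the restriction to positive
  arguments from here on.\<close>

lemma defect_empty:
  assumes "t > 0"
  shows "defect {} k t = 0"
proof -
  have "points {} t = {\<lambda>_. undefined}" using assms by (auto simp: points_def wsum_def)
  then show ?thesis
    using assms by (simp add: defect_def riesz_sum_def todd_poly_def pole_series_def fourier_def wsum_def trunc_power_def)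
qed

text \<open>A constant \<^term>\<open>defect A k\<close> vanishes because its antiderivative \<^term>\<open>defect A (Suc k)\<close> is periodic.\<close>

lemma defect_constant_imp_zero:
  assumes "k \<ge> 1" "abs_conv A (coef A k)"
    and periodic: "\<And>t. t > 0 \<Longrightarrow> defect A (Suc k) (t + w j) = defect A (Suc k) t"
    and const: "\<And>t. t > 0 \<Longrightarrow> defect A k t = C"
    and "t > 0"
  shows "defect A k t = 0"
proof -
  obtain \<xi> where "t < \<xi>" "defect A (Suc k) (t + w j) - defect A (Suc k) t = (t + w j - t) * defect A k \<xi>"
    using MVT2[of t "t + w j" "defect A (Suc k)" "defect A k"] DERIV_defect[OF assms(1,2)] w_pos[of j] by auto
  with periodic[OF \<open>t > 0\<close>] const[of \<xi>] const[OF \<open>t > 0\<close>] \<open>t > 0\<close> w_pos[of j] show ?thesis by simp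
qed

section \<open>The base case of a single weight\<close>

lemma coef_singleton: "coef {j} 1 j m = of_real (- (w j / (4 * pi\<^sup>2)) * (1 / (real (Suc m))\<^sup>2))"
proof -
  have "w j * (freq j m)\<^sup>2 = 4 * pi\<^sup>2 * (real (Suc m))\<^sup>2 / w j"
    using w_pos[of j] by (simp add: freq_def power2_eq_square del: of_nat_Suc)
  moreover have "coef {j} 1 j m = of_real (- (1 / (w j * (freq j m)\<^sup>2)))"
    by (simp add: coef_def power_mult_distrib flip: power2_eq_square)
  ultimately show ?thesis by (simp del: of_nat_Suc)
qed

lemma abs_conv_singleton: "abs_conv {j} (coef {j} 1)"
proof -
  have "norm (coef {j} 1 j m) = w j / (4 * pi\<^sup>2) * (1 / (real (Suc m))\<^sup>2)" for m
    unfolding coef_singleton norm_of_real using w_pos[of j] by (simp add: abs_mult del: of_nat_Suc)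
  then show ?thesis
    using summable_mult[OF summable_inverse_squares_Suc, of "w j / (4 * pi\<^sup>2)"]
    by (simp only: abs_conv_def singleton_iff Ball_def) simp
qed

lemma pole_series_singleton:
  "pole_series {j} 1 t = - (w j / (2 * pi\<^sup>2)) * (\<Sum>m. cos (real (Suc m) * (2 * pi * t / w j)) / (real (Suc m))\<^sup>2)"
proof -
  let ?x = "2 * pi * t / w j"
  have s: "summable (\<lambda>m. cos (real (Suc m) * ?x) / (real (Suc m))\<^sup>2)"
    by (rule summable_comparison_test'[OF summable_inverse_squares_Suc, of 0])
       (simp add: divide_right_mono del: of_nat_Suc)
  have "2 * Re (exp (\<i> * of_real (t * freq j m)) * coef {j} 1 j m)
         = - (w j / (2 * pi\<^sup>2)) * (cos (real (Suc m) * ?x) / (real (Suc m))\<^sup>2)" for m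
  proof -
    have "Re (exp (\<i> * of_real (t * freq j m))) = cos (t * freq j m)"
      unfolding Re_exp by simp
    moreover have "t * freq j m = real (Suc m) * ?x" by (simp add: freq_def)
    ultimately show ?thesis unfolding coef_singleton by (simp del: of_nat_Suc)
  qed
  then have "pole_series {j} 1 t = (\<Sum>m. - (w j / (2 * pi\<^sup>2)) * (cos (real (Suc m) * ?x) / (real (Suc m))\<^sup>2))"
    by (simp only: fourier_def pole_series_def sum.insert finite.emptyI empty_iff not_False_eq_True sum.empty add_0_right)
  then show ?thesis by (simp only: suminf_mult[OF s])
qed

lemma fps_mult_nth_2: "fps_nth (f * g) 2 = fps_nth f 0 * fps_nth g 2 + fps_nth f 1 * fps_nth g 1 + fps_nth f 2 * fps_nth g 0"
  for f g :: "real fps"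
  unfolding fps_mult_nth numeral_2_eq_2 by simp

text \<open>Up to \<open>t = w j\<close> there are no points, and the series from
  \<open>suminf_cos_div_squares\<close> cancels the quadratic \<open>todd_poly {j} 1\<close> up to a
  constant.\<close>

lemma defect_singleton_constant: "\<exists>C. \<forall>t. 0 < t \<and> t \<le> w j \<longrightarrow> defect {j} 1 t = C"
proof -
  obtain C where C: "\<And>x. 0 \<le> x \<Longrightarrow> x \<le> 2 * pi \<Longrightarrow>
      (\<Sum>m. cos (real (Suc m) * x) / (real (Suc m))\<^sup>2) = x\<^sup>2 / 4 - pi * x / 2 + C"
    using suminf_cos_div_squares by auto
  have wj: "w j > 0" by (rule w_pos)
  \<comment> \<open>The coefficients of \<open>s\<close> and \<open>s ^ 2\<close> in
    \<open>todd_mult\<close> determine the first two coefficients of \<open>todd j\<close>; the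
    third is absorbed in the constant.\<close>
  have t0: "fps_nth (todd j) 0 * w j = 1"
    using arg_cong[OF todd_mult[of j], of "\<lambda>f. fps_nth f 1"] by (simp add: fps_mult_nth)
  have "fps_nth (todd j) 0 * ((w j)\<^sup>2 / 2) + fps_nth (todd j) 1 * w j = 0"
    using arg_cong[OF todd_mult[of j], of "\<lambda>f. fps_nth f 2"]
    by (simp add: fps_mult_nth_2)
  then have "(fps_nth (todd j) 0 * w j / 2 + fps_nth (todd j) 1) * w j = 0"
    by (simp add: power2_eq_square algebra_simps)
  with t0 wj have t1: "fps_nth (todd j) 1 = - 1 / 2" by simp
  have t0': "fps_nth (todd j) 0 = 1 / w j" using t0 wj by (simp add: field_simps)
  have "defect {j} 1 t = - fps_nth (todd j) 2 + w j / (2 * pi\<^sup>2) * C" if t: "0 < t" "t \<le> w j" for t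
  proof -
    have "points {j} t = {}"
    proof -
      have ge: "wsum {j} x \<ge> w j" if "x \<in> PiE {j} (\<lambda>_. {1..})" for x
      proof -
        have "real (x j) \<ge> 1" using that by (auto simp: PiE_iff)
        then show ?thesis using wj by (simp add: wsum_def)
      qed
      have "\<not> wsum {j} x < t" if "x \<in> PiE {j} (\<lambda>_. {1..})" for x
        using ge[OF that] t(2) by linarith
      then show ?thesis unfolding points_def by blast
    qed
    then have "riesz_sum {j} 1 t = 0" by (simp add: riesz_sum_def)
    moreover have "todd_poly {j} 1 t = 1 / w j * (t\<^sup>2 / 2) - t / 2 + fps_nth (todd j) 2"
    proof -
      have "todd_poly {j} 1 t = fps_nth (todd j * fps_exp t) 2" by (simp add: todd_poly_def numeral_2_eq_2)
      then show ?thesis unfolding fps_mult_nth_2 t0' t1 by simp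
    qed
    moreover have "pole_series {j} 1 t = - (w j / (2 * pi\<^sup>2)) * ((2 * pi * t / w j)\<^sup>2 / 4 - pi * (2 * pi * t / w j) / 2 + C)"
    proof -
      have "2 * pi * (t / w j) \<le> 2 * pi * 1"
        using t wj by (intro mult_left_mono) auto
      then have "0 \<le> 2 * pi * t / w j" "2 * pi * t / w j \<le> 2 * pi" using t wj by auto
      from C[OF this] show ?thesis unfolding pole_series_singleton by (simp only:)
    qed
    moreover have "- (w j / (2 * pi\<^sup>2)) * ((2 * pi * t / w j)\<^sup>2 / 4 - pi * (2 * pi * t / w j) / 2 + C)
       = - (1 / w j * (t\<^sup>2 / 2) - t / 2) - w j / (2 * pi\<^sup>2) * C"
    proof -
      have "- (v / (2 * p\<^sup>2)) * ((2 * p * t / v)\<^sup>2 / 4 - p * (2 * p * t / v) / 2 + C)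
        = - (1 / v * (t\<^sup>2 / 2) - t / 2) - v / (2 * p\<^sup>2) * C" if "v > 0" "p > 0" for v p :: real
        using that by (simp add: power2_eq_square right_diff_distrib distrib_left)
      from this[OF wj pi_gt_zero] show ?thesis .
    qed
    ultimately show ?thesis unfolding defect_def by linarith
  qed
  then show ?thesis by blast
qed

lemma abs_conv_mono:
  assumes "abs_conv A (coef A k)" "k \<le> k'"
  shows "abs_conv A (coef A k')"
  using assms(2,1) by (induction k' rule: dec_induct) (simp_all add: abs_conv_coef_Suc)

lemma defect_periodic:
  assumes "i \<in> A" "abs_conv A (coef A k)" "\<And>t. t > 0 \<Longrightarrow> defect (A - {i}) k t = 0" "t > 0"
  shows "defect A k (t + w i) = defect A k t"
  using defect_shift[OF assms(1,2), of "t + w i"] assms(3,4) by simp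

text \<open>Periodicity spreads the constant from the first period to all positive \<open>t\<close>,
  where it must be 0. Each further level has derivative 0, so it is constant and vanishes for the
  same reason.\<close>

lemma defect_singleton:
  assumes "k \<ge> 1" "t > 0"
  shows "defect {j} k t = 0"
proof -
  have per: "defect {j} k (t + w j) = defect {j} k t" if "k \<ge> 1" "t > 0" for k t
    using that defect_empty by (intro defect_periodic abs_conv_mono[OF abs_conv_singleton]) auto
  obtain C where C: "\<And>t. 0 < t \<Longrightarrow> t \<le> w j \<Longrightarrow> defect {j} 1 t = C"
    using defect_singleton_constant by blast
  have C': "defect {j} 1 t = C" if "t > 0" for t
  proof -
    \<comment> \<open>Ceiling minus 1, so that \<open>t - n * w j\<close> falls in the period that
      is open at 0 and closed at \<open>w j\<close>, where the constant is known.\<close>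
    define n where "n = nat (\<lceil>t / w j\<rceil> - 1)"
    have "\<lceil>t / w j\<rceil> \<ge> 1" using that w_pos[of j] by simp
    then have n: "real n = of_int \<lceil>t / w j\<rceil> - 1" by (simp add: n_def)
    then have "real n < t / w j" "t / w j \<le> real n + 1" by linarith+
    then have s: "0 < t - real n * w j" "t - real n * w j \<le> w j"
      using w_pos[of j] by (simp_all add: field_simps)
    have "defect {j} 1 (t - real n * w j + real n * w j) = defect {j} 1 (t - real n * w j)"
      by (rule periodic_nat_mult[of "defect {j} 1" "w j"]) (use per w_pos s in auto)
    then show ?thesis using C[OF s] by simp
  qed
  have "\<forall>t>0. defect {j} k t = 0"
    using assms(1)
  proof (induction k rule: dec_induct)
    case base
    have "defect {j} 1 t = 0" if "t > 0" for t
      by (rule defect_constant_imp_zero[OF _ abs_conv_singleton per C' that]) auto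
    then show ?case by blast
  next
    case (step k)
    have const: "defect {j} (Suc k) t = defect {j} (Suc k) 1" if "t > 0" for t
    \<comment> \<open>This interval contains both \<open>t\<close> and 1 and stays in the positive
      half-line.\<close>
    proof (rule DERIV_isconst3[where f = "defect {j} (Suc k)" and a = "min t 1 / 2" and b = "max t 1 + 1"])
      show "DERIV (defect {j} (Suc k)) x :> 0" if "x \<in> {min t 1 / 2<..<max t 1 + 1}" for x
      proof -
        have "min t 1 / 2 > 0" using \<open>t > 0\<close> by simp
        then have "x > 0" using that by (meson greaterThanLessThan_iff less_trans)
        then show ?thesis
          using DERIV_defect[OF step.hyps(1) abs_conv_mono[OF abs_conv_singleton[of j] step.hyps(1)], of x] step.IH
          by simp
      qed
    qed (use that in auto)
    have "defect {j} (Suc k) t = 0" if "t > 0" for t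
      by (rule defect_constant_imp_zero[OF _ abs_conv_mono[OF abs_conv_singleton] per const that])
         (use step.hyps in auto)
    then show ?case by blast
  qed
  with assms(2) show ?thesis by blast
qed

text \<open>Induction on the number of weights: the shift identity and the smaller sets make the
  defect periodic with every weight in \<open>A\<close>, and two weights with irrational ratio make
  it constant, hence 0. A single weight gives only one period, which is why that case rests on an
  explicit Fourier series.\<close>

theorem riesz_sum_eq_todd_poly_plus_pole_series:
  assumes "K \<ge> 1" and conv: "\<And>A. abs_conv A (coef A K)" and "k \<ge> K" "t > 0"
  shows "riesz_sum A k t = todd_poly A k t + pole_series A k t"
proof -
  have "\<forall>k\<ge>K. \<forall>t>0. defect A k t = 0"
  proof (induction "card A" arbitrary: A rule: less_induct)
    case less
    have IH: "defect (A - {i}) k t = 0" if "i \<in> A" "k \<ge> K" "t > 0" for i k t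
    proof -
      have "card (A - {i}) < card A" using that(1) by (intro psubset_card_mono) auto
      then show ?thesis using less that by blast
    qed
    consider "A = {}" | j where "A = {j}" | i j where "i \<in> A" "j \<in> A" "i \<noteq> j" by blast
    then show ?case
    proof cases
      case 1
      then show ?thesis using defect_empty by blast
    next
      case 2
      then show ?thesis using defect_singleton \<open>K \<ge> 1\<close> by force
    next
      case 3
      have conv': "abs_conv A (coef A k)" if "k \<ge> K" for k
        using abs_conv_mono[OF conv that] .
      have per: "defect A k (t + w l) = defect A k t" if "l \<in> A" "k \<ge> K" "t > 0" for l k t
        using that IH conv' by (intro defect_periodic) auto
      \<comment> \<open>Level \<open>Suc K\<close> first: continuity comes from the derivative, so
        the level below must still converge absolutely.\<close>
      have const: "defect A k t = defect A k 1" if k: "k \<ge> Suc K" and t: "t > 0" for k t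
      proof (rule constant_if_two_irrational_periods[of "defect A k" "w i" "w j"])
        show "isCont (defect A k) x" for x
        proof -
          obtain k' where k': "k = Suc k'" "k' \<ge> K" using k by (cases k) auto
          show ?thesis
          unfolding k' using DERIV_isCont[OF DERIV_defect[OF _ conv'[OF k'(2)]]] k'(2) \<open>K \<ge> 1\<close> by simp
        qed
        show "w i > 0" "w j > 0" by (rule w_pos)+
        have "k \<ge> K" using k by simp
        then show "\<And>x. x > 0 \<Longrightarrow> defect A k (x + w i) = defect A k x" "\<And>x. x > 0 \<Longrightarrow> defect A k (x + w j) = defect A k x"
          using per 3 by blast+
        show "w i / w j \<notin> \<rat>" by (rule irrational_ratio[OF 3(3)])
      qed (use t in simp_all)
      have "defect A k t = 0" if k: "k \<ge> Suc K" and t: "t > 0" for k t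
        by (rule defect_constant_imp_zero[OF _ conv' per[OF 3(1)] const[OF k] t])
           (use k \<open>K \<ge> 1\<close> in auto)
      note * = this
      show ?thesis
      proof (intro allI impI)
        fix k and t :: real assume k: "K \<le> k" and t: "0 < t"
        \<comment> \<open>Level \<open>K\<close> is recovered by differentiating the defect one
          level up, which is 0 on the positive half-line.\<close>
        have der: "(defect A (Suc k) has_real_derivative defect A k t) (at t)"
          using k \<open>K \<ge> 1\<close> by (intro DERIV_defect conv') auto
        have "((\<lambda>_. 0) has_real_derivative defect A k t) (at t)"
          by (rule has_field_derivative_transform_within_open[OF der, of "{0<..}"]) (use * k t in auto)
        then show "defect A k t = 0" using DERIV_unique[OF _ DERIV_const] by blast
      qed
    qed
  qed
  then have "defect A k t = 0" using assms by blast
  then show ?thesis unfolding defect_def by linarith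
qed

end

section \<open>Size of the Fourier coefficients\<close>

lemma nearest_int_dist_nonneg: "0 \<le> nearest_int_dist x"
  by (simp add: nearest_int_dist_def)

lemma nearest_int_dist_le_half: "nearest_int_dist x \<le> 1 / 2"
  using of_int_round_abs_le[of x] by (simp add: nearest_int_dist_def abs_minus_commute)

lemma nearest_int_dist_eq_0: "x \<in> \<int> \<Longrightarrow> nearest_int_dist x = 0"
  by (auto simp: nearest_int_dist_def Ints_def)

text \<open>A crude Jordan inequality: up to \<open>y = 1 / 6\<close> a mean value step with cosine
  at least \<open>1 / 2\<close>, beyond it sine at least \<open>1 / 2\<close>.\<close>

lemma le_two_sin_pi:
  assumes "0 \<le> y" "y \<le> 1 / 2"
  shows "y \<le> 2 * sin (pi * y)"
proof (cases "pi * y \<le> pi / 6")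
  case True
  show ?thesis
  proof (cases "y = 0")
    case False
    with assms have y: "0 < pi * y" by simp
    obtain \<xi> where \<xi>: "0 < \<xi>" "\<xi> < pi * y" "sin (pi * y) - sin 0 = (pi * y - 0) * cos \<xi>"
      using MVT2[OF y, of sin cos] by (auto intro: DERIV_sin)
    have "cos (pi / 3) \<le> cos \<xi>"
      using \<xi> True pi_gt_zero by (intro cos_monotone_0_pi_le) linarith+
    then have "(pi * y) * (1 / 2) \<le> (pi * y) * cos \<xi>"
      using y by (intro mult_left_mono) (auto simp: cos_60)
    moreover have "1 * y \<le> pi * y"
      using assms pi_ge_two by (intro mult_right_mono) auto
    moreover have "sin (pi * y) = pi * y * cos \<xi>" using \<xi>(3) by simp
    ultimately show ?thesis by linarith
  qed auto
next
  case False
  have "pi * y \<le> pi * (1 / 2)" using assms by (intro mult_left_mono) auto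
  then have "sin (pi / 6) \<le> sin (pi * y)"
    using False pi_gt_zero by (subst sin_mono_le_eq) linarith+
  then show ?thesis using assms by (simp add: sin_30)
qed

text \<open>The right side is \<open>2 * \<bar>sin (pi * x)\<bar>\<close>, which depends only on the
  distance to the nearest integer. This links the denominators of the residues to the
  approximability condition.\<close>

lemma nearest_int_dist_le_norm_exp:
  "nearest_int_dist x \<le> norm (exp (\<i> * of_real (2 * pi * x)) - 1)"
proof -
  let ?r = "of_int (round x) :: real"
  have s0: "sin (pi * ?r) = 0" by (auto simp: sin_zero_iff_int2)
  then have c1: "\<bar>cos (pi * ?r)\<bar> = 1" using sin_cos_squared_add[of "pi * ?r"] by (simp add: abs_square_eq_1)
  have "sin (pi * x) = sin (pi * (x - ?r) + pi * ?r)" by (simp add: algebra_simps)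
  also have "\<dots> = sin (pi * (x - ?r)) * cos (pi * ?r)"
    using s0 by (simp only: sin_add)
  finally have "\<bar>sin (pi * x)\<bar> = \<bar>sin (pi * (x - ?r))\<bar>"
    using c1 by (simp add: abs_mult)
  moreover have "\<bar>sin (pi * (x - ?r))\<bar> = \<bar>sin (pi * nearest_int_dist x)\<bar>"
  proof -
    have "\<bar>sin (pi * y)\<bar> = \<bar>sin (pi * \<bar>y\<bar>)\<bar>" for y by (cases "y \<ge> 0") simp_all
    then show ?thesis unfolding nearest_int_dist_def .
  qed
  moreover have "nearest_int_dist x \<le> 2 * \<bar>sin (pi * nearest_int_dist x)\<bar>"
    using le_two_sin_pi[OF nearest_int_dist_nonneg nearest_int_dist_le_half, of x] by linarith
  ultimately show ?thesis by (simp only: dist_exp_i_1) simp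
qed

text \<open>The constant \<open>c\<close> is a parameter so that all weight vectors of one direction
  can share it, their ratios being equal.\<close>

locale approximable_weights =
  fixes w :: "'n::finite \<Rightarrow> real" and \<kappa> c :: real
  assumes weight_pos: "w j > 0" and \<kappa>_pos: "\<kappa> > 0" and c_pos: "c > 0"
    and approximable: "1 \<le> m \<Longrightarrow>
      c < real m powr (1 + \<kappa>) * (\<Prod>l\<in>UNIV - {j}. nearest_int_dist (w l / w j * real m))"
begin

lemma prod_nearest_pos:
  assumes "1 \<le> m"
  shows "(\<Prod>l\<in>UNIV - {j}. nearest_int_dist (w l / w j * real m)) > 0"
proof -
  have "0 < real m powr (1 + \<kappa>) * (\<Prod>l\<in>UNIV - {j}. nearest_int_dist (w l / w j * real m))"
    using approximable[OF assms, of j] c_pos by linarith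
  then show ?thesis by (simp add: zero_less_mult_iff)
qed

lemma nearest_pos:
  assumes "1 \<le> m" "l \<noteq> j"
  shows "nearest_int_dist (w l / w j * real m) > 0"
proof -
  have "nearest_int_dist (w l / w j * real m) \<noteq> 0"
  proof
    assume "nearest_int_dist (w l / w j * real m) = 0"
    then have "(\<Prod>l\<in>UNIV - {j}. nearest_int_dist (w l / w j * real m)) = 0"
      using assms(2) by (intro prod_zero) auto
    with prod_nearest_pos[OF assms(1), of j] show False by linarith
  qed
  then show ?thesis using nearest_int_dist_nonneg[of "w l / w j * real m"] by linarith
qed

text \<open>A ratio \<open>p / q\<close> would give distance 0 at \<open>m = q\<close>, against
  \<open>nearest_pos\<close>.\<close>

sublocale incommensurable_weights w
proof
  show "w j > 0" for j by (rule weight_pos)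
  show "w l / w j \<notin> \<rat>" if "l \<noteq> j" for l j
  proof
    assume "w l / w j \<in> \<rat>"
    then obtain p q :: int where pq: "q > 0" "w l / w j = of_int p / of_int q"
      by (elim Rats_cases') auto
    then have "w l / w j * real (nat q) = of_int p" by simp
    then have "nearest_int_dist (w l / w j * real (nat q)) = 0"
      by (intro nearest_int_dist_eq_0) (simp only: Ints_of_int)
    moreover have "1 \<le> nat q" using pq(1) by simp
    ultimately show False using nearest_pos[of "nat q" l j] that by linarith
  qed
qed

text \<open>Amplification by small denominators; the summand of \<open>incline_sum\<close> is
  \<open>amp j m / m\<close>.\<close>

definition amp :: "'n \<Rightarrow> nat \<Rightarrow> real" where
  "amp j m = 1 / (\<Prod>l\<in>UNIV - {j}. nearest_int_dist (w l / w j * real m))"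

lemma amp_ge_1:
  assumes "1 \<le> m"
  shows "amp j m \<ge> 1"
proof -
  have "(\<Prod>l\<in>UNIV - {j}. nearest_int_dist (w l / w j * real m)) \<le> (\<Prod>l\<in>UNIV - {j}. 1)"
    by (intro prod_mono conjI nearest_int_dist_nonneg order.trans[OF nearest_int_dist_le_half]) simp
  then show ?thesis using prod_nearest_pos[OF assms, of j] by (simp add: amp_def)
qed

lemma amp_le:
  assumes "1 \<le> m"
  shows "amp j m \<le> real m powr (1 + \<kappa>) / c"
  using approximable[OF assms, of j] prod_nearest_pos[OF assms, of j] c_pos
  by (simp add: amp_def divide_simps mult.commute)

text \<open>For indices outside \<open>A\<close> the factor \<open>1 / nearest_int_dist\<close> is
  at least 1, so the bound with all indices serves every subset at once.\<close>

lemma norm_coef_le: "norm (coef A k j m) \<le> amp j (Suc m) / (w j * freq j m ^ Suc k)"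
proof -
  have "norm (\<Prod>l\<in>A - {j}. 1 / (exp (\<i> * of_real (w l * freq j m)) - 1))
          \<le> (\<Prod>l\<in>A - {j}. 1 / nearest_int_dist (w l / w j * real (Suc m)))"
    unfolding prod_norm[symmetric]
  proof (intro prod_mono conjI norm_ge_zero)
    fix l assume l: "l \<in> A - {j}"
    have "w l * freq j m = 2 * pi * (w l / w j * real (Suc m))" by (simp add: freq_def)
    then have "nearest_int_dist (w l / w j * real (Suc m)) \<le> norm (exp (\<i> * of_real (w l * freq j m)) - 1)"
      using nearest_int_dist_le_norm_exp[of "w l / w j * real (Suc m)"] by (simp only:)
    moreover have "nearest_int_dist (w l / w j * real (Suc m)) > 0"
      using nearest_pos[of "Suc m" l j] l by simp
    ultimately show "norm (1 / (exp (\<i> * of_real (w l * freq j m)) - 1))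
        \<le> 1 / nearest_int_dist (w l / w j * real (Suc m))"
      unfolding norm_divide norm_one by (intro divide_left_mono mult_pos_pos) linarith+
  qed
  also have "\<dots> \<le> (\<Prod>l\<in>UNIV - {j}. 1 / nearest_int_dist (w l / w j * real (Suc m)))"
  proof (rule prod_mono2)
    fix l assume "l \<in> UNIV - {j} - (A - {j})"
    then have "nearest_int_dist (w l / w j * real (Suc m)) > 0"
      using nearest_pos[of "Suc m" l j] by simp
    then show "1 \<le> 1 / nearest_int_dist (w l / w j * real (Suc m))"
      using nearest_int_dist_le_half[of "w l / w j * real (Suc m)"] by (simp add: le_divide_eq)
  qed (use nearest_int_dist_nonneg in auto)
  also have "\<dots> = amp j (Suc m)" by (simp add: amp_def prod_dividef)
  finally show ?thesis
    using w_pos[of j] freq_pos[of j m] unfolding coef_def norm_divide norm_mult norm_power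
    by (simp add: divide_right_mono)
qed

text \<open>The exponents add up to \<open>(1 + \<kappa>) - 1 - (\<kappa> + 2) = - 2\<close>. Taking
  \<open>\<alpha> = 1\<close> gives absolute convergence of the residue series,
  \<open>\<alpha> = 1 - \<sigma>\<close> the bound on the damped tail.\<close>

lemma amp_term_le:
  assumes "1 \<le> m" "0 \<le> u" "u \<le> real m powr (- \<alpha>)" "\<kappa> + 2 \<le> \<alpha> * real k"
  shows "amp j m / real m * u ^ k \<le> 1 / c * (1 / (real m)\<^sup>2)"
proof -
  have m: "real m \<ge> 1" using assms(1) by simp
  have "u ^ k \<le> (real m powr (- \<alpha>)) ^ k" by (intro power_mono assms)
  also have "\<dots> = real m powr (- (\<alpha> * real k))"
    using m by (simp add: powr_realpow[symmetric] powr_powr)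
  also have "\<dots> \<le> real m powr (- (\<kappa> + 2))"
    using m assms(4) by (intro powr_mono) auto
  finally have "amp j m / real m * u ^ k \<le> (real m powr (1 + \<kappa>) / c) / real m * real m powr (- (\<kappa> + 2))"
    using amp_le[OF assms(1), of j] amp_ge_1[OF assms(1), of j] assms(2) c_pos
    by (intro mult_mono divide_right_mono) auto
  also have "\<dots> = 1 / c * (real m powr (1 + \<kappa>) * real m powr (- 1) * real m powr (- (\<kappa> + 2)))"
    using m by (simp add: powr_minus_divide)
  also have "real m powr (1 + \<kappa>) * real m powr (- 1) * real m powr (- (\<kappa> + 2)) = real m powr (- 2)"
    by (simp only: powr_add[symmetric]) (rule arg_cong2[where f = "(powr)"], simp_all)
  also have "real m powr (- 2) = 1 / real m powr 2" by (rule powr_minus_divide)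
  also have "real m powr 2 = (real m)\<^sup>2" using m by (intro powr_numeral) simp
  finally show ?thesis .
qed

lemma abs_conv_coef:
  assumes "\<kappa> + 2 \<le> real K"
  shows "abs_conv A (coef A K)"
  unfolding abs_conv_def
proof
  fix j
  let ?D = "1 / w j * (w j / (2 * pi)) ^ Suc K"
  show "summable (\<lambda>m. norm (coef A K j m))"
  proof (rule summable_comparison_test')
    show "summable (\<lambda>m. ?D * (1 / c) * (1 / (real (Suc m))\<^sup>2))"
      by (rule summable_mult[OF summable_inverse_squares_Suc])
    fix m :: nat
    have D: "?D > 0" using w_pos[of j] by simp
    have "norm (coef A K j m) \<le> amp j (Suc m) / (w j * freq j m ^ Suc K)" by (rule norm_coef_le)
    also have "\<dots> = ?D * (amp j (Suc m) / real (Suc m) * (1 / real (Suc m)) ^ K)"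
      using w_pos[of j] by (simp add: freq_def power_divide power_mult_distrib mult_ac del: of_nat_Suc)
    also have "\<dots> \<le> ?D * (1 / c * (1 / (real (Suc m))\<^sup>2))"
      using D assms by (intro mult_left_mono amp_term_le[where \<alpha> = 1]) (auto simp: powr_minus_divide)
    finally show "norm (norm (coef A K j m)) \<le> ?D * (1 / c) * (1 / (real (Suc m))\<^sup>2)" by simp
  qed
qed

lemma riesz_sum_eq_todd_poly_plus_pole_series':
  assumes "\<kappa> + 2 \<le> real k" "t > 0"
  shows "riesz_sum UNIV k t = todd_poly UNIV k t + pole_series UNIV k t"
  using riesz_sum_eq_todd_poly_plus_pole_series[OF _ abs_conv_coef[OF assms(1)] order_refl assms(2)] \<kappa>_pos assms(1) by simp

end

section \<open>Differences of the series and the Riesz sums, growth of the polynomial\<close>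

context incommensurable_weights
begin

lemma abs_conv_diff:
  assumes "abs_conv A a"
  shows "abs_conv A (\<lambda>j m. (exp (\<i> * of_real (h * freq j m)) - 1) * a j m)"
  unfolding abs_conv_def
proof
  fix j assume "j \<in> A"
  show "summable (\<lambda>m. norm ((exp (\<i> * of_real (h * freq j m)) - 1) * a j m))"
  proof (rule summable_comparison_test')
    show "summable (\<lambda>m. 2 * norm (a j m))"
      using assms \<open>j \<in> A\<close> by (intro summable_mult) (simp add: abs_conv_def)
    fix m
    have "norm (exp (\<i> * of_real (h * freq j m)) - 1) \<le> 2" by (simp only: dist_exp_i_1) simp
    from mult_right_mono[OF this norm_ge_zero[of "a j m"]]
    show "norm (norm ((exp (\<i> * of_real (h * freq j m)) - 1) * a j m)) \<le> 2 * norm (a j m)"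
      by (simp only: norm_mult real_norm_def abs_mult abs_norm_cancel)
  qed
qed

lemma fdiff_fourier:
  assumes "abs_conv A a"
  shows "abs_conv A (\<lambda>j m. (exp (\<i> * of_real (h * freq j m)) - 1) ^ n * a j m)"
    and "fdiff n h (fourier A a) t
           = fourier A (\<lambda>j m. (exp (\<i> * of_real (h * freq j m)) - 1) ^ n * a j m) t"
  using assms
proof (induction n arbitrary: a)
  case (Suc n)
  have eq: "(\<lambda>j m. (exp (\<i> * of_real (h * freq j m)) - 1) ^ Suc n * a j m)
     = (\<lambda>j m. (exp (\<i> * of_real (h * freq j m)) - 1) ^ n * ((exp (\<i> * of_real (h * freq j m)) - 1) * a j m))" for a
    by (simp add: mult_ac)
  {
    case (1 a)
    show ?case unfolding eq by (rule Suc.IH(1)[OF abs_conv_diff[OF 1]])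
  next
    case (2 a)
    show ?case
      unfolding eq Suc.IH(2)[OF abs_conv_diff[OF 2], symmetric] fdiff.simps
      by (simp only: fourier_diff_shift[OF 2])
  }
qed auto

text \<open>The mean value theorem handles all differences but the last. Since level 0 jumps, the
  last one uses \<open>riesz_sum_1_diff_bounds\<close> and the monotonicity of the count.\<close>

lemma fdiff_riesz_sum_bounds:
  assumes "h > 0" "k \<ge> 1"
  shows "h ^ k * riesz_sum A 0 t \<le> fdiff k h (riesz_sum A k) t" "fdiff k h (riesz_sum A k) t \<le> h ^ k * riesz_sum A 0 (t + real k * h)"
proof -
  obtain n where k: "k = Suc n" using assms(2) by (cases k) auto
  define G where "G = (\<lambda>i x. riesz_sum A (Suc i) (x + h) - riesz_sum A (Suc i) x)"
  have "(G (Suc i) has_real_derivative G i x) (at x)" for i x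
    unfolding G_def using DERIV_riesz_sum[of "Suc i"]
    by (intro DERIV_diff) (simp_all add: DERIV_shift[symmetric])
  then obtain \<xi> where \<xi>: "t \<le> \<xi>" "\<xi> \<le> t + real n * h" "fdiff n h (G n) t = h ^ n * G 0 \<xi>"
    using fdiff_mean_value[of G h t n] assms(1) by blast
  have eq: "fdiff k h (riesz_sum A k) t = h ^ n * (riesz_sum A 1 (\<xi> + h) - riesz_sum A 1 \<xi>)"
    using \<xi>(3) unfolding k G_def by simp
  have "h * riesz_sum A 0 t \<le> h * riesz_sum A 0 \<xi>" using riesz_sum_0_mono[OF \<xi>(1)] assms(1) by (intro mult_left_mono) auto
  also note riesz_sum_1_diff_bounds(1)[OF assms(1)]
  finally have "h * riesz_sum A 0 t \<le> riesz_sum A 1 (\<xi> + h) - riesz_sum A 1 \<xi>" .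
  then have "h ^ n * (h * riesz_sum A 0 t) \<le> fdiff k h (riesz_sum A k) t"
    unfolding eq using assms(1) by (intro mult_left_mono) auto
  then show "h ^ k * riesz_sum A 0 t \<le> fdiff k h (riesz_sum A k) t" unfolding k by (simp add: mult_ac)
  have "\<xi> + h \<le> t + real k * h" using \<xi>(2) unfolding k by (simp add: algebra_simps)
  then have "h * riesz_sum A 0 (\<xi> + h) \<le> h * riesz_sum A 0 (t + real k * h)"
    using riesz_sum_0_mono assms(1) by (intro mult_left_mono) auto
  with riesz_sum_1_diff_bounds(2)[OF assms(1), of A \<xi>]
  have "riesz_sum A 1 (\<xi> + h) - riesz_sum A 1 \<xi> \<le> h * riesz_sum A 0 (t + real k * h)" by linarith
  then have "h ^ n * (riesz_sum A 1 (\<xi> + h) - riesz_sum A 1 \<xi>) \<le> h ^ n * (h * riesz_sum A 0 (t + real k * h))"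
    using assms(1) by (intro mult_left_mono) auto
  then show "fdiff k h (riesz_sum A k) t \<le> h ^ k * riesz_sum A 0 (t + real k * h)"
    unfolding eq by (simp add: k mult_ac)
qed

text \<open>Level 0 is a polynomial of degree \<open>CARD('n)\<close>, so for
  \<open>z \<ge> 1\<close> its derivative is at most a multiple of
  \<open>z ^ (CARD('n) - 1)\<close>.\<close>

lemma todd_poly_increment_bound:
  "\<exists>B>0. \<forall>x y. 1 \<le> x \<and> x \<le> y \<longrightarrow> \<bar>todd_poly UNIV 0 y - todd_poly UNIV 0 x\<bar> \<le> B * y ^ (CARD('n) - 1) * (y - x)"
proof -
  define T where "T = (\<Prod>j\<in>(UNIV :: 'n set). todd j)"
  define d where "d = CARD('n) - 1"
  have card: "CARD('n) = Suc d" by (simp add: d_def)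
  define B where "B = (\<Sum>i=0..d. \<bar>fps_nth T i\<bar>) + 1"
  have "B > 0" unfolding B_def by (intro add_nonneg_pos sum_nonneg) auto
  have der: "(todd_poly UNIV 0 has_real_derivative fps_nth (T * fps_exp z) d) (at z)" for z
    unfolding todd_poly_def T_def card add_0 using DERIV_fps_nth_mult_exp .
  have bound: "\<bar>fps_nth (T * fps_exp z) d\<bar> \<le> B * z ^ d" if "1 \<le> z" for z
  proof -
    have "\<bar>fps_nth T i * (z ^ (d - i) / fact (d - i))\<bar> \<le> \<bar>fps_nth T i\<bar> * z ^ d" for i
    proof -
      have "z ^ (d - i) / fact (d - i) \<le> z ^ d / 1"
        using that by (intro frac_le power_increasing fact_ge_1) auto
      then show ?thesis using that unfolding abs_mult by (intro mult_left_mono) auto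
    qed
    then have "\<bar>fps_nth (T * fps_exp z) d\<bar> \<le> (\<Sum>i=0..d. \<bar>fps_nth T i\<bar> * z ^ d)"
      unfolding fps_mult_nth fps_exp_nth of_nat_fact by (intro order.trans[OF sum_abs] sum_mono)
    also have "\<dots> \<le> B * z ^ d"
      unfolding B_def sum_distrib_right[symmetric] using that by (intro mult_right_mono) auto
    finally show ?thesis .
  qed
  have "\<bar>todd_poly UNIV 0 y - todd_poly UNIV 0 x\<bar> \<le> B * y ^ d * (y - x)" if "1 \<le> x" "x \<le> y" for x y
  proof (cases "x = y")
    case False
    then have "x < y" using that by simp
    from MVT2[OF this, of "todd_poly UNIV 0" "\<lambda>z. fps_nth (T * fps_exp z) d"] der
    obtain z where z: "x < z" "z < y" "todd_poly UNIV 0 y - todd_poly UNIV 0 x = (y - x) * fps_nth (T * fps_exp z) d" by blast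
    have "\<bar>fps_nth (T * fps_exp z) d\<bar> \<le> B * z ^ d" using bound[of z] z that by auto
    also have "\<dots> \<le> B * y ^ d" using z that \<open>B > 0\<close> by (intro mult_left_mono power_mono) auto
    finally show ?thesis
      unfolding z(3) abs_mult using that by (simp add: mult.commute mult_left_mono)
  qed auto
  with \<open>B > 0\<close> show ?thesis unfolding d_def by blast
qed

end

section \<open>Smoothing\<close>

lemma suminf_inverse_squares_le_2: "(\<Sum>m. 1 / (real (Suc m))\<^sup>2) \<le> 2"
proof -
  have "(\<Sum>m. 1 / (real (Suc m))\<^sup>2) = pi\<^sup>2 / 6"
    using inverse_squares_sums by (simp add: sums_iff)
  moreover have "pi\<^sup>2 \<le> (3.2 :: real)\<^sup>2" using pi_approx by (intro power_mono) auto
  ultimately show ?thesis by (simp add: power2_eq_square)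
qed

context approximable_weights
begin

definition amp_sum :: "real \<Rightarrow> real" where
  "amp_sum X = (\<Sum>j\<in>UNIV. \<Sum>m | 1 \<le> m \<and> real m \<le> X. amp j m / real m)"

lemma finite_nat_le: "finite {m. 1 \<le> m \<and> real m \<le> X}"
proof (rule finite_subset)
  show "{m. 1 \<le> m \<and> real m \<le> X} \<subseteq> {..nat \<lceil>X\<rceil>}"
    by (auto simp: nat_ceiling_le_eq le_nat_iff) linarith
qed simp

lemma amp_sum_ge_1:
  assumes "X \<ge> 1"
  shows "amp_sum X \<ge> 1"
proof -
  have nonneg: "amp j m / real m \<ge> 0" if "m \<in> {m. 1 \<le> m \<and> real m \<le> X}" for j m
    using amp_ge_1[of m j] that by simp
  fix j0 :: 'n
  have "1 \<le> amp j0 1 / real 1" using amp_ge_1[of 1 j0] by simp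
  also have "\<dots> \<le> (\<Sum>m | 1 \<le> m \<and> real m \<le> X. amp j0 m / real m)"
    using assms nonneg by (intro member_le_sum[of 1] finite_nat_le) auto
  also have "\<dots> \<le> amp_sum X"
    unfolding amp_sum_def by (rule member_le_sum[of j0]) (auto intro!: sum_nonneg nonneg)
  finally show ?thesis .
qed

text \<open>\<open>u j m\<close> is a sinc factor. With \<open>h ^ k\<close> pulled out, the powers
  of the frequency reduce to \<open>1 / (w j * freq j m)\<close>, that is
  \<open>1 / (2 * pi * Suc m)\<close>. The bound 1 serves low frequencies, the decaying bound high
  ones.\<close>

lemma fdiff_pole_series_term_bound:
  assumes h: "h > 0"
  defines "u \<equiv> \<lambda>j m. norm (exp (\<i> * of_real (h * freq j m)) - 1) / (h * freq j m)"
  shows "2 * norm ((exp (\<i> * of_real (h * freq j m)) - 1) ^ k * coef A k j m)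
           \<le> h ^ k * (amp j (Suc m) / real (Suc m) * u j m ^ k)"
    and "0 \<le> u j m" "u j m \<le> 1" "u j m \<le> w j / h / real (Suc m)"
proof -
  have f: "freq j m > 0" and wj: "w j > 0" by (rule freq_pos w_pos)+
  show u0: "0 \<le> u j m" unfolding u_def using h f by simp
  have "norm (exp (\<i> * of_real (h * freq j m)) - 1) \<le> h * freq j m"
    using abs_sin_x_le_abs_x[of "h * freq j m / 2"] h f unfolding dist_exp_i_1 by (simp add: abs_mult)
  then show "u j m \<le> 1" unfolding u_def using h f by simp
  have "norm (exp (\<i> * of_real (h * freq j m)) - 1) \<le> 2" unfolding dist_exp_i_1 by simp
  then have "u j m \<le> 2 / (h * freq j m)" unfolding u_def using h f by (intro divide_right_mono) auto
  also have "2 / (h * freq j m) = (1 / pi) * (w j / h / real (Suc m))"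
    using h wj by (simp add: freq_def field_simps del: of_nat_Suc)
  also have "\<dots> \<le> 1 * (w j / h / real (Suc m))"
    using h wj pi_ge_two by (intro mult_right_mono) auto
  finally show "u j m \<le> w j / h / real (Suc m)" by simp
  have "norm (exp (\<i> * of_real (h * freq j m)) - 1) = u j m * (h * freq j m)"
    unfolding u_def using h f by simp
  then have "2 * norm ((exp (\<i> * of_real (h * freq j m)) - 1) ^ k * coef A k j m)
          = 2 * (u j m * (h * freq j m)) ^ k * norm (coef A k j m)"
    by (simp only: norm_mult norm_power mult.assoc)
  also have "\<dots> \<le> 2 * (u j m * (h * freq j m)) ^ k * (amp j (Suc m) / (w j * freq j m ^ Suc k))"
    using u0 h f by (intro mult_left_mono norm_coef_le) auto
  also have "\<dots> = h ^ k * (2 / (w j * freq j m) * amp j (Suc m) * u j m ^ k)"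
    using f wj by (simp add: power_mult_distrib)
  also have "2 / (w j * freq j m) = 1 / pi * (1 / real (Suc m))"
    using wj by (simp add: freq_def del: of_nat_Suc)
  also have "h ^ k * (1 / pi * (1 / real (Suc m)) * amp j (Suc m) * u j m ^ k)
       = 1 / pi * (h ^ k * (amp j (Suc m) / real (Suc m) * u j m ^ k))" by simp
  also have "\<dots> \<le> 1 * (h ^ k * (amp j (Suc m) / real (Suc m) * u j m ^ k))"
    using pi_ge_two u0 h amp_ge_1[of "Suc m" j] by (intro mult_right_mono) auto
  finally show "2 * norm ((exp (\<i> * of_real (h * freq j m)) - 1) ^ k * coef A k j m)
           \<le> h ^ k * (amp j (Suc m) / real (Suc m) * u j m ^ k)" by simp
qed

text \<open>Terms with index up to \<open>X\<close> use \<open>u \<le> 1\<close> and add up to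
  \<open>amp_sum X\<close>. Beyond \<open>X\<close> the condition on \<open>h\<close> gives
  \<open>u \<le> m powr (- (1 - \<sigma>))\<close>, whose \<open>k\<close>-th power beats the growth
  of \<open>amp\<close> and leaves at most \<open>2 / c\<close> for each \<open>j\<close>.\<close>

lemma fdiff_pole_series_bound:
  assumes h: "h > 0" and \<sigma>: "0 < \<sigma>" "\<sigma> < 1" and k: "\<kappa> + 2 \<le> (1 - \<sigma>) * real k"
    and X: "X \<ge> 1" and W: "\<And>j. w j / h \<le> X powr \<sigma>"
  shows "\<bar>fdiff k h (pole_series UNIV k) t\<bar> \<le> h ^ k * (amp_sum X + real CARD('n) * 2 / c)"
proof -
  have "(1 - \<sigma>) * real k \<le> 1 * real k" using \<sigma> by (intro mult_right_mono) auto
  then have conv: "abs_conv UNIV (coef UNIV k)" using k by (intro abs_conv_coef) simp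
  let ?b = "\<lambda>j m. (exp (\<i> * of_real (h * freq j m)) - 1) ^ k * coef UNIV k j m"
  let ?N = "\<lambda>j m. if real (Suc m) \<le> X then amp j (Suc m) / real (Suc m) else 0"
  have conv_b: "abs_conv UNIV ?b" by (rule fdiff_fourier(1)[OF conv])
  have "2 * norm (?b j m) \<le> h ^ k * (?N j m + 1 / c * (1 / (real (Suc m))\<^sup>2))" for j m
  proof -
    define u where "u = norm (exp (\<i> * of_real (h * freq j m)) - 1) / (h * freq j m)"
    note u = fdiff_pole_series_term_bound[OF h, where j = j and m = m, folded u_def]
    have "amp j (Suc m) / real (Suc m) * u ^ k \<le> ?N j m + 1 / c * (1 / (real (Suc m))\<^sup>2)"
    proof (cases "real (Suc m) \<le> X")
      case True
      have "amp j (Suc m) / real (Suc m) * u ^ k \<le> amp j (Suc m) / real (Suc m) * 1"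
        using amp_ge_1[of "Suc m" j] u(2,3) by (intro mult_left_mono power_le_one) auto
      moreover have "0 \<le> 1 / c * (1 / (real (Suc m))\<^sup>2)" using c_pos by simp
      ultimately show ?thesis using True by (simp only: if_True)
    next
      case False
      have "w j / h \<le> real (Suc m) powr \<sigma>"
        using W[of j] powr_mono2[of \<sigma> X "real (Suc m)"] False \<sigma> X by linarith
      then have "w j / h / real (Suc m) \<le> real (Suc m) powr \<sigma> / real (Suc m)"
        by (intro divide_right_mono) auto
      also have "\<dots> = real (Suc m) powr (- (1 - \<sigma>))" by (simp add: powr_diff)
      finally have "u \<le> real (Suc m) powr (- (1 - \<sigma>))" using u(4) by linarith
      from amp_term_le[OF _ u(2) this k, of j] show ?thesis using False by simp
    qed
    then have "h ^ k * (amp j (Suc m) / real (Suc m) * u ^ k) \<le> h ^ k * (?N j m + 1 / c * (1 / (real (Suc m))\<^sup>2))"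
      using h by (intro mult_left_mono) auto
    with u(1)[of k UNIV] show ?thesis by linarith
  qed
  note le = this
  have "(\<Sum>m. 2 * norm (?b j m)) \<le> h ^ k * ((\<Sum>m | 1 \<le> m \<and> real m \<le> X. amp j m / real m) + 2 / c)" for j
  proof -
    have "(\<lambda>m. ?N j m) sums (\<Sum>m | real (Suc m) \<le> X. ?N j m)"
    proof (rule sums_finite)
      have "{m. real (Suc m) \<le> X} \<subseteq> (\<lambda>m. m - 1) ` {m. 1 \<le> m \<and> real m \<le> X}"
        by (auto intro!: image_eqI[where x = "Suc _"])
      then show "finite {m. real (Suc m) \<le> X}" using finite_nat_le finite_surj by blast
    qed auto
    moreover have "(\<Sum>m | real (Suc m) \<le> X. ?N j m) = (\<Sum>m | 1 \<le> m \<and> real m \<le> X. amp j m / real m)"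
      by (rule sum.reindex_bij_witness[of _ "\<lambda>m. m - 1" Suc]) auto
    ultimately have N: "?N j sums (\<Sum>m | 1 \<le> m \<and> real m \<le> X. amp j m / real m)" by simp
    have sq: "(\<lambda>m. 1 / c * (1 / (real (Suc m))\<^sup>2)) sums (1 / c * (\<Sum>m. 1 / (real (Suc m))\<^sup>2))"
      by (intro sums_mult summable_sums summable_inverse_squares_Suc)
    have rhs: "(\<lambda>m. h ^ k * (?N j m + 1 / c * (1 / (real (Suc m))\<^sup>2))) sums
      (h ^ k * ((\<Sum>m | 1 \<le> m \<and> real m \<le> X. amp j m / real m) + 1 / c * (\<Sum>m. 1 / (real (Suc m))\<^sup>2)))"
      by (intro sums_mult sums_add N sq)
    have "summable (\<lambda>m. 2 * norm (?b j m))"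
      using conv_b by (intro summable_mult) (simp add: abs_conv_def)
    from sums_le[OF le summable_sums[OF this] rhs]
    have "(\<Sum>m. 2 * norm (?b j m)) \<le>
      h ^ k * ((\<Sum>m | 1 \<le> m \<and> real m \<le> X. amp j m / real m) + 1 / c * (\<Sum>m. 1 / (real (Suc m))\<^sup>2))" .
    also have "\<dots> \<le> h ^ k * ((\<Sum>m | 1 \<le> m \<and> real m \<le> X. amp j m / real m) + 1 / c * 2)"
      using h c_pos suminf_inverse_squares_le_2 by (intro mult_left_mono add_left_mono) auto
    finally show ?thesis by simp
  qed
  then have "(\<Sum>j\<in>UNIV. \<Sum>m. 2 * norm (?b j m))
      \<le> (\<Sum>j\<in>UNIV. h ^ k * ((\<Sum>m | 1 \<le> m \<and> real m \<le> X. amp j m / real m) + 2 / c))"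
    by (intro sum_mono)
  also have "\<dots> = h ^ k * (amp_sum X + real CARD('n) * 2 / c)"
    unfolding amp_sum_def sum_distrib_left[symmetric] sum.distrib by simp
  finally have "(\<Sum>j\<in>UNIV. \<Sum>m. 2 * norm (?b j m)) \<le> h ^ k * (amp_sum X + real CARD('n) * 2 / c)" .
  moreover have "fdiff k h (pole_series UNIV k) t = fourier UNIV ?b t"
    unfolding pole_series_def by (rule fdiff_fourier(2)[OF conv])
  ultimately show ?thesis using fourier_bound[OF conv_b, of t] by linarith
qed

text \<open>Take the \<open>k\<close>-th difference of the residue formula and divide by
  \<open>h ^ k\<close>: the Riesz sum lies between the counts at \<open>t\<close> and
  \<open>t + k * h\<close>, the polynomial becomes its value at \<open>\<xi>\<close>, and the series
  contributes at most \<open>Q\<close>.\<close>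

lemma sandwich:
  assumes h: "h > 0" and \<sigma>: "0 < \<sigma>" "\<sigma> < 1" and k: "\<kappa> + 2 \<le> (1 - \<sigma>) * real k"
    and X: "X \<ge> 1" and W: "\<And>j. w j / h \<le> X powr \<sigma>" and t: "t > 0"
  defines "Q \<equiv> amp_sum X + real CARD('n) * 2 / c"
  shows "\<exists>\<xi>. t \<le> \<xi> \<and> \<xi> \<le> t + real k * h \<and>
           riesz_sum UNIV 0 t \<le> todd_poly UNIV 0 \<xi> + Q \<and> todd_poly UNIV 0 \<xi> - Q \<le> riesz_sum UNIV 0 (t + real k * h)"
proof -
  have "(1 - \<sigma>) * real k \<le> 1 * real k" using \<sigma> by (intro mult_right_mono) auto
  then have k': "\<kappa> + 2 \<le> real k" using k by simp
  then have k1: "k \<ge> 1" using \<kappa>_pos by simp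
  obtain \<xi> where \<xi>: "t \<le> \<xi>" "\<xi> \<le> t + real k * h" "fdiff k h (todd_poly UNIV k) t = h ^ k * todd_poly UNIV 0 \<xi>"
    using fdiff_mean_value[of "todd_poly UNIV" h t k] DERIV_todd_poly h by blast
  have "fdiff k h (riesz_sum UNIV k) t = fdiff k h (\<lambda>y. todd_poly UNIV k y + pole_series UNIV k y) t"
    using t h by (intro fdiff_cong riesz_sum_eq_todd_poly_plus_pole_series' k') auto
  also have "\<dots> = h ^ k * todd_poly UNIV 0 \<xi> + fdiff k h (pole_series UNIV k) t"
    by (simp only: fdiff_add \<xi>(3))
  finally have eq: "fdiff k h (riesz_sum UNIV k) t = h ^ k * todd_poly UNIV 0 \<xi> + fdiff k h (pole_series UNIV k) t" .
  have Pb: "\<bar>fdiff k h (pole_series UNIV k) t\<bar> \<le> h ^ k * Q"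
    unfolding Q_def by (rule fdiff_pole_series_bound[OF h \<sigma> k X W])
  have "h ^ k * riesz_sum UNIV 0 t \<le> h ^ k * (todd_poly UNIV 0 \<xi> + Q)"
    using fdiff_riesz_sum_bounds(1)[OF h k1, of UNIV t] eq Pb unfolding distrib_left by linarith
  moreover have "h ^ k * (todd_poly UNIV 0 \<xi> - Q) \<le> h ^ k * riesz_sum UNIV 0 (t + real k * h)"
    using fdiff_riesz_sum_bounds(2)[OF h k1, of UNIV t] eq Pb unfolding right_diff_distrib by linarith
  ultimately show ?thesis using \<xi>(1,2) h by (intro exI[of _ \<xi>]) auto
qed

text \<open>The factor in \<open>h\<close> and the thresholds absorb the dependence on the size of
  \<open>w\<close>, so the displayed constants involve only \<open>c\<close>, \<open>k\<close> and
  the dimension. The range of \<open>\<tau>\<close> leaves room for the shift by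
  \<open>w \<bullet> v\<close>.\<close>

lemma riesz_sum_minus_todd_poly_bound:
  assumes "\<epsilon> > 0" and \<sigma>: "0 < \<sigma>" "\<sigma> < 1" "1 < (1 + \<epsilon>) * \<sigma>"
    and k: "\<kappa> + 2 \<le> (1 - \<sigma>) * real k"
  shows "\<exists>t0 T0. \<forall>t\<ge>t0. \<forall>T\<ge>T0. 0 < t \<and> 1 \<le> T \<and> (\<forall>\<tau>. t \<le> \<tau> \<and> \<tau> \<le> t + (\<Sum>j\<in>UNIV. w j) \<longrightarrow>
           \<bar>riesz_sum UNIV 0 \<tau> - todd_poly UNIV 0 \<tau>\<bar> \<le> amp_sum (T powr (1 + \<epsilon>)) + real CARD('n) * 2 / c
              + real k * 2 ^ (CARD('n) - 1) * (t ^ (CARD('n) - 1) / T))"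
proof -
  obtain B where B: "B > 0" "\<And>x y. 1 \<le> x \<Longrightarrow> x \<le> y \<Longrightarrow>
      \<bar>todd_poly UNIV 0 y - todd_poly UNIV 0 x\<bar> \<le> B * y ^ (CARD('n) - 1) * (y - x)"
    using todd_poly_increment_bound by blast
  define V where "V = (\<Sum>j\<in>UNIV. w j)"
  define d where "d = CARD('n) - 1"
  have V: "w j \<le> V" for j
    unfolding V_def by (rule member_le_sum) (auto intro: less_imp_le[OF w_pos])
  have "V > 0" using V[of undefined] w_pos[of undefined] by linarith
  \<comment> \<open>The spare exponent in \<open>(T powr (1 + \<epsilon>)) powr \<sigma> = T powr (1
    + \<eta>)\<close>; \<open>T powr \<eta>\<close> swallows the constant
    \<open>V * B\<close>.\<close>
  define \<eta> where "\<eta> = (1 + \<epsilon>) * \<sigma> - 1"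
  have \<eta>: "\<eta> > 0" using \<sigma> by (simp add: \<eta>_def)
  \<comment> \<open>The entry \<open>k / B\<close> makes \<open>k * h \<le> 1\<close>; the last one
    makes \<open>V * B \<le> T powr \<eta>\<close>.\<close>
  define T0 where "T0 = max (max 1 (real k / B)) ((V * B) powr (1 / \<eta>))"
  \<comment> \<open>With \<open>k * h \<le> 1\<close> this keeps all arguments between 1 and
    \<open>2 * t\<close>.\<close>
  define t0 where "t0 = V + 3"
  have "\<bar>riesz_sum UNIV 0 \<tau> - todd_poly UNIV 0 \<tau>\<bar> \<le> amp_sum (T powr (1 + \<epsilon>)) + real CARD('n) * 2 / c
              + real k * 2 ^ d * (t ^ d / T)"
    if t: "t \<ge> t0" and T: "T \<ge> T0" and \<tau>: "t \<le> \<tau>" "\<tau> \<le> t + V" for t T \<tau>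
  proof -
    \<comment> \<open>The factor \<open>1 / B\<close> cancels the constant of
      \<open>todd_poly_increment_bound\<close>.\<close>
    define h where "h = 1 / (B * T)"
    define Q where "Q = amp_sum (T powr (1 + \<epsilon>)) + real CARD('n) * 2 / c"
    have T1: "T \<ge> 1" "T \<ge> real k / B" "(V * B) powr (1 / \<eta>) \<le> T" using T by (auto simp: T0_def)
    have h: "h > 0" using B(1) T1 by (simp add: h_def)
    have kh: "real k * h \<le> 1" using T1 B(1) by (simp add: h_def field_simps)
    have X: "T powr (1 + \<epsilon>) \<ge> 1" using T1 \<open>\<epsilon> > 0\<close> by (intro ge_one_powr_ge_zero) auto
    have "((V * B) powr (1 / \<eta>)) powr \<eta> \<le> T powr \<eta>" using T1(3) \<eta> by (intro powr_mono2) auto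
    then have "V * B \<le> T powr \<eta>" using \<eta> \<open>V > 0\<close> B(1) by (simp add: powr_powr)
    then have "V * B * T \<le> T powr \<eta> * T powr 1" using T1 by simp
    also have "\<dots> = (T powr (1 + \<epsilon>)) powr \<sigma>"
      by (simp only: powr_powr powr_add[symmetric] \<eta>_def) simp
    finally have VB: "V * B * T \<le> (T powr (1 + \<epsilon>)) powr \<sigma>" .
    have W: "w j / h \<le> (T powr (1 + \<epsilon>)) powr \<sigma>" for j
    proof -
      have "w j / h = w j * (B * T)" by (simp add: h_def)
      also have "\<dots> \<le> V * (B * T)" using V B(1) T1 by (intro mult_right_mono) auto
      finally show ?thesis using VB by simp
    qed
    have bound: "\<bar>todd_poly UNIV 0 y - todd_poly UNIV 0 x\<bar> \<le> real k * 2 ^ d * (t ^ d / T)"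
      if "1 \<le> x" "x \<le> y" "y \<le> 2 * t" "y - x \<le> real k * h" for x y
    proof -
      have "\<bar>todd_poly UNIV 0 y - todd_poly UNIV 0 x\<bar> \<le> B * y ^ d * (y - x)" unfolding d_def using that by (intro B) auto
      also have "\<dots> \<le> B * (2 * t) ^ d * (real k * h)"
        using that B(1) by (intro mult_mono mult_left_mono power_mono) auto
      also have "\<dots> = real k * 2 ^ d * (t ^ d / T)"
        using B(1) T1 by (simp add: h_def power_mult_distrib)
      finally show ?thesis .
    qed
    have big: "t \<ge> V + 3" using t by (simp add: t0_def)
    obtain \<xi> where \<xi>: "\<tau> \<le> \<xi>" "\<xi> \<le> \<tau> + real k * h" "riesz_sum UNIV 0 \<tau> \<le> todd_poly UNIV 0 \<xi> + Q"
      using sandwich[OF h \<sigma>(1,2) k X W, of \<tau>] \<tau> big \<open>V > 0\<close> unfolding Q_def by auto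
    have "\<bar>todd_poly UNIV 0 \<xi> - todd_poly UNIV 0 \<tau>\<bar> \<le> real k * 2 ^ d * (t ^ d / T)"
      using \<xi> \<tau> big kh \<open>V > 0\<close> by (intro bound) linarith+
    then have up: "riesz_sum UNIV 0 \<tau> - todd_poly UNIV 0 \<tau> \<le> Q + real k * 2 ^ d * (t ^ d / T)" using \<xi>(3) by linarith
    \<comment> \<open>The reverse inequality starts the sandwich at \<open>\<tau> - k * h\<close>,
      so that its right end is \<open>\<tau>\<close>.\<close>
    obtain \<zeta> where \<zeta>: "\<tau> - real k * h \<le> \<zeta>" "\<zeta> \<le> \<tau>" "todd_poly UNIV 0 \<zeta> - Q \<le> riesz_sum UNIV 0 \<tau>"
    proof -
      have "\<tau> - real k * h > 0" using \<tau> big kh \<open>V > 0\<close> by linarith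
      from sandwich[OF h \<sigma>(1,2) k X W this] show ?thesis using that unfolding Q_def by auto
    qed
    have "\<bar>todd_poly UNIV 0 \<tau> - todd_poly UNIV 0 \<zeta>\<bar> \<le> real k * 2 ^ d * (t ^ d / T)"
      using \<zeta> \<tau> big kh \<open>V > 0\<close> by (intro bound) linarith+
    then have "todd_poly UNIV 0 \<tau> - riesz_sum UNIV 0 \<tau> \<le> Q + real k * 2 ^ d * (t ^ d / T)" using \<zeta>(3) by linarith
    with up show ?thesis unfolding Q_def by linarith
  qed
  then show ?thesis
    using \<open>V > 0\<close> unfolding d_def V_def
    by (intro exI[of _ t0] exI[of _ T0] allI impI conjI) (auto simp: t0_def T0_def V_def)
qed

end

section \<open>One-sided limits and the lattice point count\<close>

lemma trunc_power_0_one_sided_limits: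
  "\<exists>l. ((\<lambda>s. trunc_power 0 (s - a)) \<longlongrightarrow> l) (at_left t)" "\<exists>l. ((\<lambda>s. trunc_power 0 (s - a)) \<longlongrightarrow> l) (at_right t)"
proof -
  have "\<forall>\<^sub>F s in at_left t. trunc_power 0 (s - a) = (if a < t then 1 else 0)"
  proof (cases "a < t")
    case True
    then show ?thesis
      unfolding eventually_at_left_field by (intro exI[of _ a]) (auto simp: trunc_power_def)
  next
    case False
    then show ?thesis
      unfolding eventually_at_left_field by (intro exI[of _ "t - 1"]) (auto simp: trunc_power_def)
  qed
  then show "\<exists>l. ((\<lambda>s. trunc_power 0 (s - a)) \<longlongrightarrow> l) (at_left t)"
    by (intro exI tendsto_eventually)
  have "\<forall>\<^sub>F s in at_right t. trunc_power 0 (s - a) = (if a \<le> t then 1 else 0)"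
  proof (cases "a \<le> t")
    case True
    then show ?thesis
      unfolding eventually_at_right_field by (intro exI[of _ "t + 1"]) (auto simp: trunc_power_def)
  next
    case False
    then show ?thesis
      unfolding eventually_at_right_field by (intro exI[of _ a]) (auto simp: trunc_power_def)
  qed
  then show "\<exists>l. ((\<lambda>s. trunc_power 0 (s - a)) \<longlongrightarrow> l) (at_right t)"
    by (intro exI tendsto_eventually)
qed

lemma abs_Lim_le:
  fixes f g :: "real \<Rightarrow> real"
  assumes "F \<noteq> bot" "(f \<longlongrightarrow> l) F" "(g \<longlongrightarrow> b) F" "\<forall>\<^sub>F s in F. \<bar>f s\<bar> \<le> g s"
  shows "\<bar>Lim F f\<bar> \<le> b"
proof -
  have "Lim F f = l" using assms(1,2) by (rule tendsto_Lim)
  then show ?thesis using tendsto_le[OF assms(1,3) tendsto_rabs[OF assms(2)] assms(4)] by simp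
qed

context incommensurable_weights
begin

lemma riesz_sum_0_one_sided_limits:
  "\<exists>l. (riesz_sum A 0 \<longlongrightarrow> l) (at_left t)" "\<exists>l. (riesz_sum A 0 \<longlongrightarrow> l) (at_right t)"
proof -
  let ?S = "\<lambda>s. \<Sum>x\<in>points A (t + 1). trunc_power 0 (s - wsum A x)"
  have eq: "?S s = riesz_sum A 0 s" if "s \<le> t + 1" for s using riesz_sum_eq_sum[OF that] by simp
  have "\<forall>x. \<exists>l. ((\<lambda>s. trunc_power 0 (s - wsum A x)) \<longlongrightarrow> l) (at_left t)"
    by (intro allI trunc_power_0_one_sided_limits)
  from choice[OF this]
  obtain l where l: "\<And>x. ((\<lambda>s. trunc_power 0 (s - wsum A x)) \<longlongrightarrow> l x) (at_left t)" by blast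
  have lim: "(?S \<longlongrightarrow> (\<Sum>x\<in>points A (t + 1). l x)) (at_left t)"
    by (intro tendsto_sum l)
  have "\<forall>\<^sub>F s in at_left t. ?S s = riesz_sum A 0 s"
    unfolding eventually_at_left_field by (intro exI[of _ "t - 1"]) (auto intro!: eq)
  from Lim_transform_eventually[OF lim this] show "\<exists>l. (riesz_sum A 0 \<longlongrightarrow> l) (at_left t)"
    by (rule exI)
  have "\<forall>x. \<exists>l. ((\<lambda>s. trunc_power 0 (s - wsum A x)) \<longlongrightarrow> l) (at_right t)"
    by (intro allI trunc_power_0_one_sided_limits)
  from choice[OF this]
  obtain l where l: "\<And>x. ((\<lambda>s. trunc_power 0 (s - wsum A x)) \<longlongrightarrow> l x) (at_right t)" by blast
  have lim: "(?S \<longlongrightarrow> (\<Sum>x\<in>points A (t + 1). l x)) (at_right t)"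
    by (intro tendsto_sum l)
  have "\<forall>\<^sub>F s in at_right t. ?S s = riesz_sum A 0 s"
    unfolding eventually_at_right_field by (intro exI[of _ "t + 1"]) (auto intro!: eq)
  from Lim_transform_eventually[OF lim this] show "\<exists>l. (riesz_sum A 0 \<longlongrightarrow> l) (at_right t)"
    by (rule exI)
qed

text \<open>For \<open>v\<close> in the half-open unit cube, an integer exceeds \<open>v $ j\<close>
  just when it is at least 1.\<close>

lemma lattice_count_eq_riesz_sum:
  fixes v :: "real ^ 'n"
  assumes "\<And>j. 0 \<le> v $ j" "\<And>j. v $ j < 1"
  shows "real (lattice_count t (\<chi> j. w j) v) = riesz_sum UNIV 0 (t + (\<chi> j. w j) \<bullet> v)"
proof -
  let ?f = "\<lambda>x :: 'n \<Rightarrow> nat. (\<chi> j. int (x j)) :: int ^ 'n"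
  let ?X = "{x :: int ^ 'n. (\<forall>j. v $ j < of_int (x $ j)) \<and>
             (\<Sum>j\<in>UNIV. (\<chi> j. w j) $ j * of_int (x $ j)) < t + (\<chi> j. w j) \<bullet> v}"
  have pos: "v $ j < of_int i \<longleftrightarrow> 1 \<le> i" for j and i :: int
  proof
    assume "v $ j < of_int i"
    with assms(1)[of j] have "(0 :: real) < of_int i" by linarith
    then show "1 \<le> i" by simp
  next
    assume "1 \<le> i"
    then have "(1 :: real) \<le> of_int i" by simp
    with assms(2)[of j] show "v $ j < of_int i" by linarith
  qed
  have "bij_betw ?f (points UNIV (t + (\<chi> j. w j) \<bullet> v)) ?X"
  proof (rule bij_betw_byWitness[where f' = "\<lambda>x j. nat (x $ j)"])
    show "\<forall>x\<in>?X. ?f (\<lambda>j. nat (x $ j)) = x"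
    proof
      fix x assume "x \<in> ?X"
      then have "1 \<le> x $ j" for j by (simp add: pos)
      then have "0 \<le> x $ j" for j using order.trans zero_le_one by blast
      then show "?f (\<lambda>j. nat (x $ j)) = x" by (simp add: vec_eq_iff)
    qed
    show "?f ` points UNIV (t + (\<chi> j. w j) \<bullet> v) \<subseteq> ?X"
      by (auto simp: points_def wsum_def pos PiE_iff)
    show "(\<lambda>x j. nat (x $ j)) ` ?X \<subseteq> points UNIV (t + (\<chi> j. w j) \<bullet> v)"
    proof (rule image_subsetI)
      fix x assume x: "x \<in> ?X"
      then have 1: "1 \<le> x $ j" for j by (simp add: pos)
      then have "real (nat (x $ j)) = of_int (x $ j)" for j
        using order.trans[OF zero_le_one 1[of j]] by simp
      moreover have "1 \<le> nat (x $ j)" for j using 1[of j] by linarith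
      ultimately show "(\<lambda>j. nat (x $ j)) \<in> points UNIV (t + (\<chi> j. w j) \<bullet> v)"
        using x by (auto simp: points_def wsum_def PiE_iff)
    qed
  qed auto
  then show ?thesis unfolding lattice_count_def riesz_sum_0 by (simp only: bij_betw_same_card)
qed

text \<open>The factors \<open>e ^ (w j * s / 2)\<close> undo the shift by \<open>1 / 2\<close> in
  the sawtooth; the product of the weights and the factorial cancel against the
  normalisation.\<close>

lemma leading_term_eq_todd_poly:
  fixes v :: "real ^ 'n"
  assumes "\<And>j. 0 \<le> v $ j" "\<And>j. v $ j < 1"
  shows "leading_term t (\<chi> j. w j) v = todd_poly UNIV 0 (t + (\<chi> j. w j) \<bullet> v)"
proof -
  define W where "W = (\<Prod>j\<in>(UNIV :: 'n set). w j)"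
  have "W > 0" unfolding W_def by (intro prod_pos) (simp add: w_pos)
  have "sawtooth_vec v $ j = v $ j - 1 / 2" for j
    using assms[of j] by (simp add: sawtooth_vec_def frac_eq)
  then have saw: "t + (\<chi> j. w j) \<bullet> sawtooth_vec v + (\<Sum>j\<in>UNIV. w j / 2) = t + (\<chi> j. w j) \<bullet> v"
    by (simp add: inner_vec_def right_diff_distrib sum_subtractf)
  have "(fps_const (w j) * fps_X * fps_exp (w j / 2)) / (fps_exp (w j) - 1)
          = fps_const (w j) * fps_exp (w j / 2) * todd j" for j
  proof -
    have "(fps_const (w j) * fps_exp (w j / 2)) * (fps_X / (fps_exp (w j) - 1))
        = ((fps_const (w j) * fps_exp (w j / 2)) * fps_X) / (fps_exp (w j) - 1)"
      by (rule div_mult_swap[OF fps_exp_dvd_X])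
    then show ?thesis unfolding todd_def by (simp add: mult_ac)
  qed
  moreover have "(\<Prod>j\<in>A. fps_const (w j)) = fps_const (\<Prod>j\<in>A. w j)" for A :: "'n set"
    by (induction A rule: infinite_finite_induct) auto
  moreover have "(\<Prod>j\<in>A. fps_exp (w j / 2)) = fps_exp (\<Sum>j\<in>A. w j / 2)" for A :: "'n set"
    by (induction A rule: infinite_finite_induct) (auto simp: fps_exp_add_mult)
  ultimately have "(\<Prod>j\<in>UNIV. (fps_const (w j) * fps_X * fps_exp (w j / 2)) / (fps_exp (w j) - 1))
      * fps_exp (t + (\<chi> j. w j) \<bullet> sawtooth_vec v)
     = fps_const W * ((\<Prod>j\<in>UNIV. todd j) *
         (fps_exp (t + (\<chi> j. w j) \<bullet> sawtooth_vec v) * fps_exp (\<Sum>j\<in>UNIV. w j / 2)))"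
    unfolding W_def by (simp add: prod.distrib mult_ac)
  also have "\<dots> = fps_const W * ((\<Prod>j\<in>UNIV. todd j) * fps_exp (t + (\<chi> j. w j) \<bullet> v))"
    unfolding fps_exp_add_mult[symmetric] saw ..
  finally show ?thesis
    unfolding leading_term_def multi_bernoulli_def todd_poly_def using \<open>W > 0\<close> by (simp flip: W_def)
qed

end

context approximable_weights
begin

lemma remainder_max_bound:
  assumes "\<epsilon> > 0" and \<sigma>: "0 < \<sigma>" "\<sigma> < 1" "1 < (1 + \<epsilon>) * \<sigma>"
    and k: "\<kappa> + 2 \<le> (1 - \<sigma>) * real k"
  shows "\<exists>t0 T0. \<forall>t\<ge>t0. \<forall>T\<ge>T0. 0 < t \<and> 1 \<le> T \<and> (\<forall>v. (\<forall>j. 0 \<le> v $ j \<and> v $ j < 1) \<longrightarrow>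
           remainder_max t (\<chi> j. w j) v \<le> amp_sum (T powr (1 + \<epsilon>)) + real CARD('n) * 2 / c
              + real k * 2 ^ (CARD('n) - 1) * (t ^ (CARD('n) - 1) / T))"
proof -
  obtain t0 T0 where *: "\<And>t T. t \<ge> t0 \<Longrightarrow> T \<ge> T0 \<Longrightarrow> 0 < t \<and> 1 \<le> T"
    "\<And>t T \<tau>. t \<ge> t0 \<Longrightarrow> T \<ge> T0 \<Longrightarrow> t \<le> \<tau> \<Longrightarrow> \<tau> \<le> t + (\<Sum>j\<in>UNIV. w j) \<Longrightarrow>
           \<bar>riesz_sum UNIV 0 \<tau> - todd_poly UNIV 0 \<tau>\<bar> \<le> amp_sum (T powr (1 + \<epsilon>)) + real CARD('n) * 2 / c
              + real k * 2 ^ (CARD('n) - 1) * (t ^ (CARD('n) - 1) / T)"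
    using riesz_sum_minus_todd_poly_bound[OF assms] by metis
  have main: "remainder_max t (\<chi> j. w j) v \<le> amp_sum (T powr (1 + \<epsilon>)) + real CARD('n) * 2 / c
              + real k * 2 ^ (CARD('n) - 1) * (t ^ (CARD('n) - 1) / T)"
    if t: "t \<ge> t0 + 1" and T: "T \<ge> T0" and v: "\<And>j. 0 \<le> v $ j \<and> v $ j < 1" for t T v
  proof -
    \<comment> \<open>The bound as a continuous function of the argument, so that it passes to both
      one-sided limits; the threshold \<open>t0 + 1\<close> leaves room to the left of
      \<open>t\<close>.\<close>
    define g where "g = (\<lambda>s. amp_sum (T powr (1 + \<epsilon>)) + real CARD('n) * 2 / c
              + real k * 2 ^ (CARD('n) - 1) * (s ^ (CARD('n) - 1) / T))"
    define a where "a = (\<chi> j. w j) \<bullet> v"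
    have a: "0 \<le> a" "a \<le> (\<Sum>j\<in>UNIV. w j)"
    proof -
      show "0 \<le> a" unfolding a_def inner_vec_def using v less_imp_le[OF w_pos]
        by (auto intro!: sum_nonneg mult_nonneg_nonneg)
      have "w j * v $ j \<le> w j" for j
        using mult_left_mono[of "v $ j" 1 "w j"] v[of j] w_pos[of j] by simp
      then show "a \<le> (\<Sum>j\<in>UNIV. w j)" unfolding a_def inner_vec_def by (simp add: sum_mono)
    qed
    have rem: "remainder s (\<chi> j. w j) v = riesz_sum UNIV 0 (s + a) - todd_poly UNIV 0 (s + a)" for s
    proof -
      have v': "0 \<le> v $ j" "v $ j < 1" for j using v[of j] by auto
      show ?thesis unfolding remainder_def a_def lattice_count_eq_riesz_sum[OF v'] leading_term_eq_todd_poly[OF v'] ..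
    qed
    have bound: "\<bar>remainder s (\<chi> j. w j) v\<bar> \<le> g s" if "s \<ge> t0" for s
      unfolding rem g_def using *(2)[OF that T, of "s + a"] a by simp
    have g: "(g \<longlongrightarrow> g t) (at t within S)" for S
      unfolding g_def using *(1)[of t0 T] T by (intro tendsto_intros) auto
    have L: "((\<lambda>s. todd_poly UNIV 0 (s + a)) \<longlongrightarrow> todd_poly UNIV 0 (t + a)) (at t within S)" for S
    proof -
      have "isCont (todd_poly UNIV 0) x" for x
        unfolding todd_poly_def fps_mult_nth fps_exp_nth by (intro continuous_intros) simp
      moreover have "isCont (\<lambda>s. s + a) t" by (intro continuous_intros)
      ultimately have "isCont (\<lambda>s. todd_poly UNIV 0 (s + a)) t" using isCont_o2 by blast
      then show ?thesis unfolding isCont_def by (rule tendsto_within_subset) simp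
    qed
    obtain l where l: "(riesz_sum UNIV 0 \<longlongrightarrow> l) (at_left (t + a))"
      using riesz_sum_0_one_sided_limits(1)[of UNIV "t + a"] by (elim exE)
    obtain r where r: "(riesz_sum UNIV 0 \<longlongrightarrow> r) (at_right (t + a))"
      using riesz_sum_0_one_sided_limits(2)[of UNIV "t + a"] by (elim exE)
    have shift: "filterlim (\<lambda>s. s + a) (at_left (t + a)) (at_left t)"
       "filterlim (\<lambda>s. s + a) (at_right (t + a)) (at_right t)"
      by (auto simp: filterlim_at eventually_at_filter intro!: tendsto_intros)
    have left: "((\<lambda>s. remainder s (\<chi> j. w j) v) \<longlongrightarrow> l - todd_poly UNIV 0 (t + a)) (at_left t)"
      unfolding rem by (intro tendsto_diff L filterlim_compose[OF l shift(1)])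
    have right: "((\<lambda>s. remainder s (\<chi> j. w j) v) \<longlongrightarrow> r - todd_poly UNIV 0 (t + a)) (at_right t)"
      unfolding rem by (intro tendsto_diff L filterlim_compose[OF r shift(2)])
    have "\<forall>\<^sub>F s in at_left t. \<bar>remainder s (\<chi> j. w j) v\<bar> \<le> g s"
      unfolding eventually_at_left_field using t by (intro exI[of _ "t - 1"]) (auto intro!: bound)
    then have 1: "\<bar>Lim (at_left t) (\<lambda>s. remainder s (\<chi> j. w j) v)\<bar> \<le> g t"
      by (intro abs_Lim_le[OF _ left g]) auto
    have "\<forall>\<^sub>F s in at_right t. \<bar>remainder s (\<chi> j. w j) v\<bar> \<le> g s"
      unfolding eventually_at_right_field using t by (intro exI[of _ "t + 1"]) (auto intro!: bound)
    then have 2: "\<bar>Lim (at_right t) (\<lambda>s. remainder s (\<chi> j. w j) v)\<bar> \<le> g t"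
      by (intro abs_Lim_le[OF _ right g]) auto
    from 1 2 show ?thesis unfolding remainder_max_def g_def by simp
  qed
  have pos: "0 < t \<and> 1 \<le> T" if "t \<ge> t0 + 1" "T \<ge> T0" for t T
    using *(1)[of t T] that by simp
  show ?thesis
    by (intro exI[of _ "t0 + 1"] exI[of _ T0] allI impI conjI main) (use pos in auto)
qed

end

section \<open>Reduction to fractional parts and the final constants\<close>

lemma lattice_count_frac_vec:
  fixes w u :: "real ^ 'n"
  shows "lattice_count t w (frac_vec u) = lattice_count t w u"
proof -
  let ?X = "\<lambda>u. {x :: int ^ 'n. (\<forall>j. u $ j < of_int (x $ j)) \<and>
             (\<Sum>j\<in>UNIV. w $ j * of_int (x $ j)) < t + w \<bullet> u}"
  have fr: "frac_vec u $ j = u $ j - of_int \<lfloor>u $ j\<rfloor>" for j by (simp add: frac_vec_def frac_def)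
  have inn: "w \<bullet> frac_vec u = w \<bullet> u - (\<Sum>j\<in>UNIV. w $ j * of_int \<lfloor>u $ j\<rfloor>)"
    unfolding inner_vec_def fr by (simp add: right_diff_distrib sum_subtractf)
  have "bij_betw (\<lambda>x. \<chi> j. x $ j - \<lfloor>u $ j\<rfloor>) (?X u) (?X (frac_vec u))"
    by (rule bij_betw_byWitness[where f' = "\<lambda>x. \<chi> j. x $ j + \<lfloor>u $ j\<rfloor>"])
       (auto simp: fr inn vec_eq_iff algebra_simps sum_subtractf sum.distrib)
  then show ?thesis unfolding lattice_count_def by (simp only: bij_betw_same_card)
qed

lemma inclines_sgn:
  assumes "w \<noteq> 0"
  shows "inclines (sgn w) = inclines w"
  using assms by (simp add: inclines_def sgn_div_norm vec_eq_iff)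

text \<open>The dependence of the implied constant lies in the quantifiers: \<open>C\<close> is
  fixed before \<open>w'\<close> ranges over the positive vectors with the direction of
  \<open>w\<close>, and only the thresholds for \<open>t\<close> and \<open>T\<close> may depend on
  \<open>w'\<close>.\<close>

theorem theorem4p1:
  fixes w :: "real ^ 'n" and \<delta> \<kappa> :: real
  assumes "2 \<le> CARD('n)"
    and "\<forall>j. 0 < w $ j"
    and "0 < \<delta>" "\<delta> < 1 / 2"
    and "0 < \<kappa>" "mult_approximable \<kappa> (inclines (sgn w))"
  shows "(\<forall>t>0. \<forall>u. real (lattice_count t w u)
              = leading_term t w (frac_vec u) + remainder t w (frac_vec u)) \<and>
         (\<forall>\<epsilon>>0. \<exists>C>0. \<forall>w' :: real ^ 'n. (\<forall>j. 0 < w' $ j) \<and> sgn w' = sgn w \<longrightarrow>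
            (\<exists>t0 T0. \<forall>t\<ge>t0. \<forall>T\<ge>T0.
               remainder_sup \<delta> t w' \<le>
                 ereal (C * (incline_sum (inclines (sgn w)) (T powr (1 + \<epsilon>))
                               + t ^ (CARD('n) - 1) / T))))"
proof (intro conjI allI impI)
  fix t :: real and u :: "real ^ 'n"
  show "real (lattice_count t w u) = leading_term t w (frac_vec u) + remainder t w (frac_vec u)"
    by (simp add: remainder_def lattice_count_frac_vec)
next
  fix \<epsilon> :: real assume \<epsilon>: "\<epsilon> > 0"
  obtain c where c: "c > 0" "\<And>m j. 1 \<le> m \<Longrightarrow> c < real m powr (1 + \<kappa>) *
        (\<Prod>l\<in>UNIV - {j}. nearest_int_dist (inclines (sgn w) $ j $ l * real m))"
    using assms(6) unfolding mult_approximable_def by blast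
  \<comment> \<open>Strictly between \<open>1 / (1 + \<epsilon>)\<close> and 1: the lower limit
    admits a step of order \<open>1 / T\<close>, the upper one keeps the tail damped.\<close>
  define \<sigma> where "\<sigma> = 1 / (1 + \<epsilon> / 2)"
  have \<sigma>: "0 < \<sigma>" "\<sigma> < 1" "1 < (1 + \<epsilon>) * \<sigma>" using \<epsilon> by (auto simp: \<sigma>_def field_simps)
  define k where "k = nat \<lceil>(\<kappa> + 2) / (1 - \<sigma>)\<rceil>"
  have "(\<kappa> + 2) / (1 - \<sigma>) \<le> real k" unfolding k_def by linarith
  then have k: "\<kappa> + 2 \<le> (1 - \<sigma>) * real k" using \<sigma> by (simp add: field_simps)
  \<comment> \<open>The first entry absorbs the constant tail, as \<open>amp_sum\<close> is at least
    1; the second covers the displacement of the polynomial.\<close>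
  define C where "C = max (1 + real CARD('n) * 2 / c) (real k * 2 ^ (CARD('n) - 1))"
  have "0 < 1 + real CARD('n) * 2 / c" using c(1) by (simp add: add_pos_nonneg)
  then have C: "C > 0" by (simp add: C_def)
  show "\<exists>C>0. \<forall>w' :: real ^ 'n. (\<forall>j. 0 < w' $ j) \<and> sgn w' = sgn w \<longrightarrow>
            (\<exists>t0 T0. \<forall>t\<ge>t0. \<forall>T\<ge>T0.
               remainder_sup \<delta> t w' \<le>
                 ereal (C * (incline_sum (inclines (sgn w)) (T powr (1 + \<epsilon>))
                               + t ^ (CARD('n) - 1) / T)))"
  proof (rule exI[of _ C], intro conjI allI impI C)
    fix w' :: "real ^ 'n" assume w': "(\<forall>j. 0 < w' $ j) \<and> sgn w' = sgn w"
    then have "w' \<noteq> 0" by (metis less_irrefl zero_index)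
    then have "inclines (sgn w) = inclines w'" using w' inclines_sgn[of w'] by simp
    then have \<Theta>: "inclines (sgn w) $ j $ l = w' $ l / w' $ j" for j l
      by (simp add: inclines_def)
    \<comment> \<open>The inclines of \<open>w'\<close> and \<open>w\<close> agree, so the same
      \<open>c\<close> serves.\<close>
    interpret approximable_weights "\<lambda>j. w' $ j" \<kappa> c
      by unfold_locales (use w' assms(5) c[unfolded \<Theta>] in auto)
    have sum_eq: "incline_sum (inclines (sgn w)) X = amp_sum X" for X
      unfolding incline_sum_def amp_sum_def amp_def \<Theta> by (simp add: mult.commute)
    obtain t0 T0 where *: "\<And>t T. t \<ge> t0 \<Longrightarrow> T \<ge> T0 \<Longrightarrow> 0 < t \<and> 1 \<le> T"
      "\<And>t T v. t \<ge> t0 \<Longrightarrow> T \<ge> T0 \<Longrightarrow> \<forall>j. 0 \<le> v $ j \<and> v $ j < 1 \<Longrightarrow>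
           remainder_max t w' v \<le> amp_sum (T powr (1 + \<epsilon>)) + real CARD('n) * 2 / c
              + real k * 2 ^ (CARD('n) - 1) * (t ^ (CARD('n) - 1) / T)"
      using remainder_max_bound[OF \<epsilon> \<sigma> k] unfolding vec_lambda_eta by metis
    have "remainder_sup \<delta> t w' \<le> ereal (C * (amp_sum (T powr (1 + \<epsilon>)) + t ^ (CARD('n) - 1) / T))"
      if t: "t \<ge> t0" and T: "T \<ge> T0" for t T
      unfolding remainder_sup_def
    proof (rule SUP_least)
      fix u :: "real ^ 'n"
      have tT: "0 < t" "1 \<le> T" using *(1)[OF t T] by auto
      have "1 \<le> amp_sum (T powr (1 + \<epsilon>))"
        using tT \<epsilon> by (intro amp_sum_ge_1 ge_one_powr_ge_zero) auto
      then have "amp_sum (T powr (1 + \<epsilon>)) + real CARD('n) * 2 / c * 1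
          \<le> amp_sum (T powr (1 + \<epsilon>)) + real CARD('n) * 2 / c * amp_sum (T powr (1 + \<epsilon>))"
        using c(1) by (intro add_left_mono mult_left_mono) auto
      also have "\<dots> = (1 + real CARD('n) * 2 / c) * amp_sum (T powr (1 + \<epsilon>))"
        by (simp add: algebra_simps)
      also have "\<dots> \<le> C * amp_sum (T powr (1 + \<epsilon>))"
        using \<open>1 \<le> amp_sum _\<close> by (intro mult_right_mono) (auto simp: C_def)
      finally have 1: "amp_sum (T powr (1 + \<epsilon>)) + real CARD('n) * 2 / c \<le> C * amp_sum (T powr (1 + \<epsilon>))"
        by simp
      have 2: "real k * 2 ^ (CARD('n) - 1) * (t ^ (CARD('n) - 1) / T) \<le> C * (t ^ (CARD('n) - 1) / T)"
        using tT by (intro mult_right_mono) (auto simp: C_def)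
      have "remainder_max t w' (frac_vec u) \<le> amp_sum (T powr (1 + \<epsilon>)) + real CARD('n) * 2 / c
              + real k * 2 ^ (CARD('n) - 1) * (t ^ (CARD('n) - 1) / T)"
        by (intro *(2) t T) (simp add: frac_vec_def frac_lt_1)
      with 1 2 show "ereal (remainder_max t w' (frac_vec u))
          \<le> ereal (C * (amp_sum (T powr (1 + \<epsilon>)) + t ^ (CARD('n) - 1) / T))"
        unfolding ereal_less_eq distrib_left by linarith
    qed
    then show "\<exists>t0 T0. \<forall>t\<ge>t0. \<forall>T\<ge>T0. remainder_sup \<delta> t w' \<le>
         ereal (C * (incline_sum (inclines (sgn w)) (T powr (1 + \<epsilon>)) + t ^ (CARD('n) - 1) / T))"
      unfolding sum_eq by blast
  qed
qed

end
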